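(* Let $n\ge 1$ and let $h_1,\dots,h_m\in M_2(\mathbb C)^{\otimes n}$ be traceless self-adjoint operators, each supported on $2$ qubits and normalized so that $\|h_i\|=1$. For every unitary $U\in M_2(\mathbb C)^{\otimes n}$, $$\operatorname{CiS}^1(U)\le 8\,\operatorname{Cost}(U),$$ where $\operatorname{Cost}(U)$ is the circuit cost of $U$ with respect to $h_1,\dots,h_m$.
   Context: On $M_2(\mathbb{C})^{\otimes n}\cong M_{2^n}(\mathbb{C})$ (trace $\operatorname{tr}$, identity $\mathbf 1$, operator norm $\|\cdot\|$), $\|A\|_1=2^{-n}\operatorname{tr}|A|$; $d_j=\mathbb I^{\otimes(j-1)}\otimes(\mathbb I-\tfrac12\operatorname{tr}(\cdot)\mathbf 1)\otimes\mathbb I^{\otimes(n-j)}$ ($\mathbb I$ the identity map on $M_2(\mathbb{C})$); $\operatorname{Inf}^1(A)=\sum_{j=1}^n\|d_jA\|_1$. $L^1$-circuit sensitivity: $\operatorname{CiS}^1(U)=\max\{|\operatorname{Inf}^1(UOU^* )-\operatorname{Inf}^1(O)|: O\in M_2(\mathbb C)^{\otimes n},\ \|O\|_1=1\}$. Circuit cost: $\operatorname{Cost}(U)=\inf\int_0^1\sum_{j=1}^m|r_j(s)|\,ds$, the infimum over all continuous functions $r_j:[0,1]\to\mathbb R$ such that, with $H(s)=\sum_{j=1}^mr_j(s)h_j$, one has $U=\mathcal P\exp(-i\int_0^1H(s)\,ds)$ (path-ordered exponential, i.e. $U=V(1)$ where $V'(s)=-iH(s)V(s)$, $V(0)=\mathbf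 1$). The infimum over the empty set is $+\infty$. *)

theory Defs
  imports "HOL-Analysis.Analysis"
begin

text \<open>
  The qubits are labelled by a finite type \<open>'n\<close>, so that \<open>n = CARD('n) \<ge> 1\<close>. The computational basis of
  the \<open>n\<close>-qubit space is indexed by bit strings \<open>x :: 'n \<Rightarrow> bool\<close>, and an element of the
  \<open>n\<close>-fold tensor power of the 2 by 2 complex matrices is a matrix indexed by pairs of bit strings.
\<close>

type_synonym 'n op = "complex ^ ('n \<Rightarrow> bool) ^ ('n \<Rightarrow> bool)"

definition cscale :: "complex \<Rightarrow> complex ^ 'a ^ 'b \<Rightarrow> complex ^ 'a ^ 'b"  (infixr "*\<^sub>c" 75)
  where "c *\<^sub>c A = (\<chi> x y. c * A $ x $ y)"

definition adj :: "complex ^ 'a ^ 'b \<Rightarrow> complex ^ 'b ^ 'a"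
  where "adj A = (\<chi> x y. cnj (A $ y $ x))"

definition selfadjoint :: "complex ^ 'a ^ 'a \<Rightarrow> bool"
  where "selfadjoint A \<longleftrightarrow> adj A = A"

definition unitary :: "complex ^ 'a ^ 'a \<Rightarrow> bool"
  where "unitary U \<longleftrightarrow> adj U ** U = mat 1 \<and> U ** adj U = mat 1"

definition op_norm :: "complex ^ 'a ^ 'b \<Rightarrow> real"
  where "op_norm A = onorm (\<lambda>v. A *v v)"

text \<open>
  On \<open>complex ^ 'a\<close> the library's (real) inner product is the real part of the Hermitian one; for
  self-adjoint \<open>A\<close> the Hermitian form \<open>\<langle>v, A v\<rangle>\<close> is real anyway.
\<close>

definition pos_semidef :: "complex ^ 'a ^ 'a \<Rightarrow> bool"
  where "pos_semidef A \<longleftrightarrow> selfadjoint A \<and> (\<forall>v. 0 \<le> v \<bullet> (A *v v))"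

text \<open>\<open>|A|\<close>, the unique positive semidefinite square root of \<open>A\<^sup>* A\<close>.\<close>

definition mat_abs :: "complex ^ 'a ^ 'a \<Rightarrow> complex ^ 'a ^ 'a"
  where "mat_abs A = (THE B. pos_semidef B \<and> B ** B = adj A ** A)"

text \<open>The normalized trace norm; the trace of \<open>|A|\<close> is a nonnegative real.\<close>

definition norm1 :: "('n::finite) op \<Rightarrow> real"
  where "norm1 A = Re (trace (mat_abs A)) / 2 ^ CARD('n)"

definition tensor_op :: "(('n::finite) \<Rightarrow> complex ^ bool ^ bool) \<Rightarrow> 'n op"
  where "tensor_op a = (\<chi> x y. \<Prod>k\<in>UNIV. a k $ x k $ y k)"

text \<open>
  The matrix entries of \<open>A\<close> minus half of (partial trace of \<open>A\<close> over qubit \<open>j\<close>, tensored with the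
  identity on qubit \<open>j\<close>). The lemma \<open>d_op_tensor_op\<close> below says that on product operators this is the
  map \<open>a \<mapsto> a - tr(a)/2\<close> applied to the \<open>j\<close>-th factor, which by linearity determines it.
\<close>

definition d_op :: "('n::finite) \<Rightarrow> 'n op \<Rightarrow> 'n op"
  where "d_op j A = (\<chi> x y. A $ x $ y -
    (if x j = y j then (\<Sum>b\<in>UNIV. A $ (x(j := b)) $ (y(j := b))) / 2 else 0))"

lemma d_op_tensor_op:
  "d_op j (tensor_op a) = tensor_op (a(j := a j - (trace (a j) / 2) *\<^sub>c mat 1))"
proof -
  have rem: "(\<Prod>k\<in>UNIV. f k) = f j * (\<Prod>k\<in>UNIV - {j}. f k)" for f :: "'a \<Rightarrow> complex"
    by (simp add: prod.remove)
  have upd: "(\<Prod>k\<in>UNIV - {j}. a k $ (x(j := b)) k $ (y(j := b)) k)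
      = (\<Prod>k\<in>UNIV - {j}. a k $ x k $ y k)" for x y b
    by (rule prod.cong) auto
  have upd': "(\<Prod>k\<in>UNIV - {j}. (a(j := c)) k $ x k $ y k)
      = (\<Prod>k\<in>UNIV - {j}. a k $ x k $ y k)" for x y c
    by (rule prod.cong) auto
  show ?thesis
    unfolding d_op_def tensor_op_def vec_eq_iff
    by (simp only: vec_lambda_beta rem upd upd')
      (auto simp: cscale_def mat_def trace_def UNIV_bool algebra_simps add_divide_distrib)
qed

lemma d_op_linear:
  "d_op j (A + B) = d_op j A + d_op j B"
  "d_op j (c *\<^sub>c A) = c *\<^sub>c d_op j A"
  by (auto simp: d_op_def cscale_def vec_eq_iff sum.distrib add_divide_distrib
      sum_distrib_left algebra_simps)

definition Inf1 :: "('n::finite) op \<Rightarrow> real"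
  where "Inf1 A = (\<Sum>j\<in>UNIV. norm1 (d_op j A))"

text \<open>
  \<open>A\<close> is of the form \<open>B\<close> on the qubits in \<open>S\<close>, tensored with the identity on the remaining qubits.
\<close>

definition supported_on :: "('n::finite) set \<Rightarrow> 'n op \<Rightarrow> bool"
  where "supported_on S A \<longleftrightarrow> (\<exists>B :: ('n \<Rightarrow> bool) \<Rightarrow> ('n \<Rightarrow> bool) \<Rightarrow> complex. \<forall>x y.
    A $ x $ y = (if \<forall>k. k \<notin> S \<longrightarrow> x k = y k then B (restrict x S) (restrict y S) else 0))"

text \<open>
  The maximum is rendered as a supremum in the extended reals; it is attained, because the unit
  sphere of \<open>norm1\<close> is compact and nonempty and the function is continuous.
\<close>

definition CiS1 :: "('n::finite) op \<Rightarrow> ereal"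
  where "CiS1 U = (SUP A \<in> {A. norm1 A = 1}. ereal \<bar>Inf1 (U ** A ** adj U) - Inf1 A\<bar>)"

text \<open>\<open>U\<close> is the path-ordered exponential of \<open>-\<i> H\<close> over \<open>[0, 1]\<close>.\<close>

definition path_ordered_exp :: "(real \<Rightarrow> ('n::finite) op) \<Rightarrow> 'n op \<Rightarrow> bool"
  where "path_ordered_exp H U \<longleftrightarrow> (\<exists>V. V 0 = mat 1 \<and>
    (\<forall>s\<in>{0..1}. (V has_vector_derivative (- \<i>) *\<^sub>c (H s ** V s)) (at s within {0..1})) \<and>
    U = V 1)"

text \<open>The infimum is taken in the extended reals, where the infimum of the empty set is \<open>\<infinity>\<close>.\<close>

definition Cost :: "nat \<Rightarrow> (nat \<Rightarrow> ('n::finite) op) \<Rightarrow> 'n op \<Rightarrow> ereal"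
  where "Cost m h U = Inf {ereal (integral {0..1} (\<lambda>s. \<Sum>j=1..m. \<bar>r j s\<bar>)) | r :: nat \<Rightarrow> real \<Rightarrow> real.
    (\<forall>j\<in>{1..m}. continuous_on {0..1} (r j)) \<and>
    path_ordered_exp (\<lambda>s. \<Sum>j=1..m. r j s *\<^sub>R h j) U}"

end

theory Submission
  imports Defs
begin

text \<open>
  Let \<open>V\<close> solve \<open>V' = - \<i> H V\<close> and put \<open>O(s) = V(s) O V(s)\<^sup>*\<close>, so that \<open>O' = - \<i> [H, O]\<close> and \<open>\<parallel>O(s)\<parallel>\<^sub>1\<close> is
  constant. In \<open>d\<^sub>j O\<close> the terms \<open>r\<^sub>k h\<^sub>k\<close> of \<open>H\<close> not acting on qubit \<open>j\<close> commute with \<open>d\<^sub>j\<close> and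
  contribute \<open>- \<i> [K, d\<^sub>j O]\<close> with \<open>K\<close> self-adjoint, which does not change the trace norm to first
  order. Every other term contributes at most \<open>\<parallel>d\<^sub>j [r\<^sub>k h\<^sub>k, O]\<parallel>\<^sub>1 \<le> 2 \<cdot> 2 |r\<^sub>k| \<parallel>O\<parallel>\<^sub>1\<close>, and each \<open>h\<^sub>k\<close> acts on at
  most two qubits, whence \<open>8 \<Sum>\<^sub>k |r\<^sub>k|\<close> for the rate of change of the influence. The properties of the
  trace norm come from the duality \<open>\<parallel>A\<parallel>\<^sub>1 = max Re tr (Q A)\<close> over contractions \<open>Q\<close>, that is, from the
  polar decomposition.
\<close>

section \<open>Complex matrices\<close>

lemma cscale_nth [simp]: "(c *\<^sub>c A) $ x $ y = c * A $ x $ y"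
  by (simp add: cscale_def)

lemma adj_nth [simp]: "adj A $ x $ y = cnj (A $ y $ x)"
  by (simp add: adj_def)

lemma cscale_simps:
  "c *\<^sub>c (A + B) = c *\<^sub>c A + c *\<^sub>c B" "c *\<^sub>c (A - B) = c *\<^sub>c A - c *\<^sub>c B"
  "(c + d) *\<^sub>c A = c *\<^sub>c A + d *\<^sub>c A" "(c - d) *\<^sub>c A = c *\<^sub>c A - d *\<^sub>c A"
  "c *\<^sub>c d *\<^sub>c A = (c * d) *\<^sub>c A" "1 *\<^sub>c A = A" "0 *\<^sub>c A = 0" "c *\<^sub>c 0 = 0"
  "c *\<^sub>c (r *\<^sub>R A) = r *\<^sub>R (c *\<^sub>c A)" "(- c) *\<^sub>c A = - (c *\<^sub>c A)"
  "c *\<^sub>c (- A) = - (c *\<^sub>c A)"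
  by (simp_all add: vec_eq_iff algebra_simps)

lemma scaleR_eq_cscale: "r *\<^sub>R A = complex_of_real r *\<^sub>c A"
  by (simp add: vec_eq_iff) (simp add: scaleR_conv_of_real)

lemma cscale_mult:
  fixes A :: "complex ^ 'b::finite ^ 'a::finite" and B :: "complex ^ 'c::finite ^ 'b"
  shows "(c *\<^sub>c A) ** B = c *\<^sub>c (A ** B)" "A ** (c *\<^sub>c B) = c *\<^sub>c (A ** B)"
  by (simp_all add: vec_eq_iff matrix_matrix_mult_def sum_distrib_left mult_ac)

lemma cscale_mult_vec:
  fixes A :: "complex ^ 'b::finite ^ 'a::finite"
  shows "(c *\<^sub>c A) *v v = c *s (A *v v)"
  by (simp add: vec_eq_iff matrix_vector_mult_def sum_distrib_left mult_ac)

lemma matrix_diff_distrib: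
  fixes A B :: "complex ^ 'b::finite ^ 'a::finite" and C D :: "complex ^ 'c::finite ^ 'b"
  shows "(A - B) ** C = A ** C - B ** C" "A ** (C - D) = A ** C - A ** D"
  by (simp_all add: vec_eq_iff matrix_matrix_mult_def sum_subtractf algebra_simps)

lemma matrix_minus_mult:
  fixes A :: "complex ^ 'b::finite ^ 'a::finite" and B :: "complex ^ 'c::finite ^ 'b"
  shows "(- A) ** B = - (A ** B)" "A ** (- B) = - (A ** B)"
  by (simp_all add: vec_eq_iff matrix_matrix_mult_def sum_negf)

lemma matrix_add_distrib:
  fixes A B :: "complex ^ 'b::finite ^ 'a::finite" and C D :: "complex ^ 'c::finite ^ 'b"
  shows "(A + B) ** C = A ** C + B ** C" "A ** (C + D) = A ** C + A ** D"
  by (simp_all add: vec_eq_iff matrix_matrix_mult_def sum.distrib algebra_simps)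

lemma matrix_scaleR_mult:
  fixes A :: "complex ^ 'b::finite ^ 'a::finite" and B :: "complex ^ 'c::finite ^ 'b"
  shows "(r *\<^sub>R A) ** B = r *\<^sub>R (A ** B)" "A ** (r *\<^sub>R B) = r *\<^sub>R (A ** B)"
  by (simp_all add: vec_eq_iff matrix_matrix_mult_def scaleR_sum_right)

lemma matrix_sum_mult:
  fixes A :: "complex ^ 'b::finite ^ 'a::finite" and C :: "complex ^ 'c::finite ^ 'b"
  shows "(\<Sum>i\<in>I. f i) ** C = (\<Sum>i\<in>I. f i ** C)" "A ** (\<Sum>i\<in>I. g i) = (\<Sum>i\<in>I. A ** g i)"
proof -
  show "(\<Sum>i\<in>I. f i) ** C = (\<Sum>i\<in>I. f i ** C)"
    by (induction I rule: infinite_finite_induct) (simp_all add: matrix_add_distrib)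
  show "A ** (\<Sum>i\<in>I. g i) = (\<Sum>i\<in>I. A ** g i)"
    by (induction I rule: infinite_finite_induct) (simp_all add: matrix_add_distrib)
qed

lemma adj_simps [simp]:
  "adj (A + B) = adj A + adj B" "adj (A - B) = adj A - adj B" "adj (c *\<^sub>c A) = cnj c *\<^sub>c adj A"
  "adj (adj A) = A" "adj (mat 1) = mat 1" "adj (r *\<^sub>R A) = r *\<^sub>R adj A" "adj 0 = 0"
  "adj (- A) = - adj A"
  by (auto simp: vec_eq_iff mat_def)

lemma adj_mult [simp]:
  fixes A :: "complex ^ 'b::finite ^ 'a::finite" and B :: "complex ^ 'c::finite ^ 'b"
  shows "adj (A ** B) = adj B ** adj A"
  by (simp add: vec_eq_iff matrix_matrix_mult_def mult_ac)

lemma trace_cscale [simp]: "trace (c *\<^sub>c A) = c * trace A"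
  for A :: "complex ^ 'a::finite ^ 'a"
  by (simp add: trace_def sum_distrib_left)

section \<open>Adjoints, the operator norm and unitaries\<close>

lemma inner_complex_Re: "x \<bullet> y = Re (cnj x * y)"
  by (simp add: inner_complex_def)

lemma adj_inner: "u \<bullet> (A *v v) = (adj A *v u) \<bullet> v"
  for A :: "complex ^ 'b::finite ^ 'a::finite"
proof -
  have "u \<bullet> (A *v v) = (\<Sum>i\<in>UNIV. \<Sum>j\<in>UNIV. Re (cnj (u $ i) * (A $ i $ j * v $ j)))"
    by (simp only: inner_vec_def inner_complex_Re matrix_vector_mult_def vec_lambda_beta
        sum_distrib_left Re_sum)
  also have "\<dots> = (\<Sum>j\<in>UNIV. \<Sum>i\<in>UNIV. Re (cnj (u $ i) * (A $ i $ j * v $ j)))"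
    by (rule sum.swap)
  also have "\<dots> = (adj A *v u) \<bullet> v"
    by (simp only: inner_vec_def inner_complex_Re matrix_vector_mult_def vec_lambda_beta
        sum_distrib_right Re_sum cnj_sum adj_nth complex_cnj_mult complex_cnj_cnj)
      (simp only: mult_ac)
  finally show ?thesis .
qed

lemma op_norm_bound: "norm (A *v v) \<le> op_norm A * norm v"
  for A :: "complex ^ 'b::finite ^ 'a::finite"
  unfolding op_norm_def by (rule onorm[OF matrix_vector_mul_bounded_linear])

lemma op_norm_nonneg: "0 \<le> op_norm A"
  for A :: "complex ^ 'b::finite ^ 'a::finite"
  unfolding op_norm_def by (rule onorm_pos_le[OF matrix_vector_mul_bounded_linear])

lemma op_norm_le: "0 \<le> c \<Longrightarrow> (\<And>v. norm (A *v v) \<le> c * norm v) \<Longrightarrow> op_norm A \<le> c"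
  for A :: "complex ^ 'b::finite ^ 'a::finite"
  unfolding op_norm_def by (rule onorm_bound)

lemma op_norm_mult: "op_norm (A ** B) \<le> op_norm A * op_norm B"
  for A :: "complex ^ 'b::finite ^ 'a::finite" and B :: "complex ^ 'c::finite ^ 'b"
proof (rule op_norm_le)
  fix v
  have "norm ((A ** B) *v v) = norm (A *v (B *v v))" by (simp add: matrix_vector_mul_assoc)
  also have "\<dots> \<le> op_norm A * norm (B *v v)" by (rule op_norm_bound)
  also have "\<dots> \<le> op_norm A * (op_norm B * norm v)"
    by (intro mult_left_mono op_norm_bound op_norm_nonneg)
  finally show "norm ((A ** B) *v v) \<le> op_norm A * op_norm B * norm v" by (simp add: mult.assoc)
qed (simp add: op_norm_nonneg)

lemma norm_scalar_vec: "norm (c *s v) = norm c * norm v" for v :: "complex ^ 'a::finite"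
  by (simp add: norm_vec_def L2_set_right_distrib norm_mult)

lemma op_norm_cscale: "op_norm (c *\<^sub>c A) \<le> norm c * op_norm A"
  for A :: "complex ^ 'b::finite ^ 'a::finite"
proof (rule op_norm_le)
  show "norm ((c *\<^sub>c A) *v v) \<le> norm c * op_norm A * norm v" for v
    by (simp add: cscale_mult_vec norm_scalar_vec mult.assoc mult_left_mono op_norm_bound)
qed (simp add: op_norm_nonneg)

lemma unitary_norm: "unitary U \<Longrightarrow> norm (U *v v) = norm v"
  for U :: "complex ^ 'a::finite ^ 'a"
  by (simp add: norm_eq_sqrt_inner adj_inner matrix_vector_mul_assoc unitary_def)

lemma op_norm_unitary: "unitary U \<Longrightarrow> op_norm U \<le> 1"
  for U :: "complex ^ 'a::finite ^ 'a"
  by (rule op_norm_le) (simp_all add: unitary_norm)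

lemma unitary_mult: "unitary U \<Longrightarrow> unitary V \<Longrightarrow> unitary (U ** V)"
  for U V :: "complex ^ 'a::finite ^ 'a"
  unfolding unitary_def adj_mult by (metis matrix_mul_assoc matrix_mul_lid)

lemma unitary_adj: "unitary U \<Longrightarrow> unitary (adj U)"
  for U :: "complex ^ 'a::finite ^ 'a"
  unfolding unitary_def by simp

lemma unitary_mat1: "unitary (mat 1 :: complex ^ 'a::finite ^ 'a)"
  unfolding unitary_def by simp

lemma norm_entry_le_op_norm: "norm (A $ i $ j) \<le> op_norm A"
  for A :: "complex ^ 'b::finite ^ 'a::finite"
proof -
  have "(A *v axis j 1) $ i = A $ i $ j"
    by (simp add: matrix_vector_mult_def axis_def if_distrib cong: if_cong)
  then have "norm (A $ i $ j) \<le> norm (A *v axis j 1)"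
    by (metis Finite_Cartesian_Product.norm_nth_le)
  also have "\<dots> \<le> op_norm A" using op_norm_bound[of A "axis j 1"] by (simp add: norm_eq_sqrt_inner inner_axis_axis)
  finally show ?thesis .
qed

section \<open>Continuity of the matrix operations and compactness of the unitary group\<close>

lemma bounded_linear_adj: "bounded_linear (adj :: complex ^ 'b::finite ^ 'a::finite \<Rightarrow> _)"
  unfolding linear_conv_bounded_linear[symmetric] by (rule linearI) simp_all

lemma bounded_bilinear_matrix_mult:
  "bounded_bilinear ((**) :: complex ^ 'b::finite ^ 'a::finite \<Rightarrow> complex ^ 'c::finite ^ 'b \<Rightarrow> _)"
  unfolding bilinear_conv_bounded_bilinear[symmetric] bilinear_def
  by (auto intro!: linearI simp: matrix_add_distrib matrix_scaleR_mult)

lemma bounded_linear_trace: "bounded_linear (trace :: complex ^ 'a::finite ^ 'a \<Rightarrow> _)"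
  unfolding linear_conv_bounded_linear[symmetric]
  by (rule linearI) (simp_all add: trace_def sum.distrib scaleR_sum_right)

text \<open>Heine-Borel: the entries of a unitary have modulus at most 1, and the two defining
  equations are closed conditions. Compactness supplies the maximiser in the polar
  decomposition.\<close>

lemma compact_unitary: "compact {U :: complex ^ 'a::finite ^ 'a. unitary U}"
proof -
  have "norm U \<le> (\<Sum>i\<in>(UNIV::'a set). \<Sum>j\<in>(UNIV::'a set). 1)" if "unitary U" for U :: "complex ^ 'a ^ 'a"
  proof -
    have "norm U \<le> (\<Sum>i\<in>UNIV. norm (U $ i))"
      unfolding norm_vec_def by (rule L2_set_le_sum) simp
    also have "\<dots> \<le> (\<Sum>i\<in>UNIV. \<Sum>j\<in>UNIV. norm (U $ i $ j))"
      by (intro sum_mono) (simp add: norm_vec_def L2_set_le_sum)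
    also have "\<dots> \<le> (\<Sum>i\<in>(UNIV::'a set). \<Sum>j\<in>(UNIV::'a set). 1)"
      by (intro sum_mono) (meson norm_entry_le_op_norm op_norm_unitary order_trans that)
    finally show ?thesis .
  qed
  then have "bounded {U :: complex ^ 'a ^ 'a. unitary U}" by (auto simp: bounded_iff)
  moreover have "closed {U :: complex ^ 'a ^ 'a. unitary U}"
    unfolding unitary_def Collect_conj_eq
    by (intro closed_Int closed_Collect_eq continuous_intros
        bounded_bilinear.continuous_on[OF bounded_bilinear_matrix_mult]
        bounded_linear.continuous_on[OF bounded_linear_adj])
  ultimately show ?thesis by (simp add: compact_eq_bounded_closed)
qed

section \<open>Positive semidefinite matrices\<close>

definition rank_one :: "complex ^ 'a \<Rightarrow> complex ^ 'a ^ 'a" where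
  "rank_one v = (\<chi> i j. v $ i * cnj (v $ j))"

definition herm :: "complex ^ 'a \<Rightarrow> complex ^ 'a \<Rightarrow> complex" where
  "herm u v = (\<Sum>i\<in>UNIV. cnj (u $ i) * v $ i)"

lemma Re_herm: "Re (herm u v) = u \<bullet> v"
  by (simp add: herm_def inner_vec_def inner_complex_Re)

lemma Im_herm: "Im (herm u v) = (\<i> *s u) \<bullet> v"
proof -
  have "(\<i> *s u) \<bullet> v = Re (- \<i> * herm u v)"
    unfolding herm_def sum_distrib_left by (simp add: inner_vec_def inner_complex_Re)
  then show ?thesis by simp
qed

lemma herm_self: "herm v v = of_real ((norm v)\<^sup>2)"
proof (rule complex_eqI)
  show "Re (herm v v) = Re (of_real ((norm v)\<^sup>2))"
    by (simp add: Re_herm power2_norm_eq_inner)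
  show "Im (herm v v) = Im (of_real ((norm v)\<^sup>2))"
    by (simp add: herm_def)
qed

lemma rank_one_mult_vec: "rank_one v *v w = herm v w *s v"
  by (simp add: vec_eq_iff rank_one_def herm_def matrix_vector_mult_def sum_distrib_left
      sum_distrib_right mult_ac)

lemma rank_one_square: "rank_one v ** rank_one v = of_real ((norm v)\<^sup>2) *\<^sub>c rank_one v"
  unfolding herm_self[symmetric]
  by (simp add: vec_eq_iff rank_one_def herm_def matrix_matrix_mult_def
      sum_distrib_left sum_distrib_right mult_ac)

lemma adj_rank_one [simp]: "adj (rank_one v) = rank_one v"
  by (simp add: vec_eq_iff rank_one_def)

lemma trace_mult_rank_one: "trace (A ** rank_one v) = herm v (A *v v)"
  by (simp add: trace_def rank_one_def herm_def matrix_matrix_mult_def matrix_vector_mult_def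
      sum_distrib_left mult_ac)

text \<open>The matrix multiplies \<open>v\<close> by the phase \<open>z\<close> and fixes the
  Hermitian orthogonal complement of \<open>v\<close>. In the product with the adjoint, the
  coefficient of \<open>rank_one v\<close> vanishes exactly because
  \<open>z * cnj z = 1\<close>.\<close>

lemma unitary_rank_one_update:
  assumes "norm z = 1" "v \<noteq> 0"
  shows "unitary (mat 1 + ((z - 1) / of_real ((norm v)\<^sup>2)) *\<^sub>c rank_one v)"
proof -
  define c where "c = (z - 1) / of_real ((norm v)\<^sup>2)"
  have zz: "z * cnj z = 1" using assms(1) by (simp add: complex_norm_square[symmetric])
  have n0: "complex_of_real ((norm v)\<^sup>2) \<noteq> 0" using assms(2) by simp
  have c: "c + cnj c + c * cnj c * of_real ((norm v)\<^sup>2) = 0"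
    unfolding c_def using n0 zz by (simp add: field_simps)
  have "(mat 1 + d *\<^sub>c rank_one v) ** (mat 1 + e *\<^sub>c rank_one v)
      = mat 1 + (d + e + d * e * of_real ((norm v)\<^sup>2)) *\<^sub>c rank_one v" for d e
    by (simp add: matrix_add_distrib cscale_mult rank_one_square cscale_simps mult.assoc mult.left_commute add.assoc)
  from this[of c "cnj c"] this[of "cnj c" c] c show ?thesis
    unfolding unitary_def c_def[symmetric] by (simp add: cscale_simps(7) mult_ac add_ac del: of_real_power)
qed

section \<open>The polar decomposition\<close>

lemma psd_selfadjoint: "pos_semidef B \<Longrightarrow> adj B = B"
  by (simp add: pos_semidef_def selfadjoint_def)

lemma i_inner: "(\<i> *s u) \<bullet> w = - (u \<bullet> (\<i> *s w))" for u w :: "complex ^ 'a::finite"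
  by (simp add: inner_vec_def inner_complex_Re sum_negf[symmetric])

text \<open>Over the complex numbers a real-valued quadratic form forces self-adjointness, by
  polarisation.\<close>

lemma pos_semidefI_herm:
  fixes B :: "complex ^ 'a::finite ^ 'a"
  assumes "\<And>v. Im (herm v (B *v v)) = 0" "\<And>v. 0 \<le> Re (herm v (B *v v))"
  shows "pos_semidef B"
proof -
  have z: "(\<i> *s v) \<bullet> (B *v v) = 0" for v using assms(1)[of v] by (simp add: Im_herm)
  \<comment> \<open>Polarise: expand the vanishing imaginary part at \<open>u + v\<close>.\<close>
  have alt: "(\<i> *s u) \<bullet> (B *v v) = - ((\<i> *s v) \<bullet> (B *v u))" for u v
    using z[of "u + v"] z[of u] z[of v]
    by (simp add: vector_add_ldistrib matrix_vector_right_distrib inner_add_left inner_add_right)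
  have sym: "(B *v u) \<bullet> v = (adj B *v u) \<bullet> v" for u v
  proof -
    \<comment> \<open>Replacing \<open>u\<close> by \<open>- \<i> *s u\<close> in \<open>alt\<close>
      turns the antisymmetry of the imaginary part into the symmetry of the real part.\<close>
    have ii: "\<i> *s (- \<i> *s u) = u" by (simp add: vec_eq_iff)
    have "u \<bullet> (B *v v) = - ((\<i> *s v) \<bullet> (B *v (- \<i> *s u)))"
      using alt[of "- \<i> *s u" v] by (simp only: ii)
    also have "\<dots> = v \<bullet> (\<i> *s (B *v (- \<i> *s u)))" by (simp add: i_inner)
    also have "\<dots> = v \<bullet> (B *v u)"
      by (simp only: vector_scalar_commute[symmetric] ii)
    finally show ?thesis using adj_inner[of u B v] inner_commute[of v "B *v u"] by simp
  qed
  have "B *v u = adj B *v u" for u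
    using sym[of u] vector_eq_rdot[of "B *v u" "adj B *v u"] by simp
  then have "adj B = B" by (simp add: matrix_eq)
  then show ?thesis using assms(2) by (simp add: pos_semidef_def selfadjoint_def Re_herm)
qed

text \<open>A unitary \<open>U\<close> maximising \<open>Re tr (U A)\<close> works: perturbing it by unitaries that differ from the
  identity in rank one forces \<open>\<langle>v, U A v\<rangle> \<ge> 0\<close> for every \<open>v\<close>.\<close>
lemma polar_decomposition:
  fixes A :: "complex ^ 'a::finite ^ 'a"
  obtains U where "unitary U" "pos_semidef (U ** A)"
proof -
  have "continuous_on {U. unitary U} (\<lambda>U. Re (trace (U ** A)))"
    by (intro continuous_intros bounded_linear.continuous_on[OF bounded_linear_trace]
        bounded_bilinear.continuous_on[OF bounded_bilinear_matrix_mult])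
  then obtain U where U: "unitary U"
    and max: "\<And>W. unitary W \<Longrightarrow> Re (trace (W ** A)) \<le> Re (trace (U ** A))"
    using continuous_attains_sup[OF compact_unitary] unitary_mat1 by (metis empty_iff mem_Collect_eq)
  define B where "B = U ** A"
  \<comment> \<open>An equation \<open>of_real (norm w) = w\<close> says at once that
    \<open>w\<close> is real and nonnegative.\<close>
  have key: "complex_of_real (norm (herm v (B *v v))) = herm v (B *v v)" for v
  proof (cases "herm v (B *v v) = 0")
    case False
    define w where "w = herm v (B *v v)"
    \<comment> \<open>The phase that rotates \<open>w\<close> onto the positive real axis.\<close>
    define z where "z = cnj w / of_real (norm w)"
    have w: "w \<noteq> 0" using False by (simp add: w_def)
    have v: "v \<noteq> 0" using False by (auto simp: herm_def)
    have z: "norm z = 1" using w by (simp add: z_def norm_divide)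
    have zw: "z * w = of_real (norm w)"
      using w by (simp add: z_def mult.commute complex_norm_square[symmetric] power2_eq_square)
    define c where "c = (z - 1) / of_real ((norm v)\<^sup>2)"
    have "unitary ((mat 1 + c *\<^sub>c rank_one v) ** U)"
      unfolding c_def by (intro unitary_mult unitary_rank_one_update z v U)
    from max[OF this] have "Re (c * trace (rank_one v ** B)) \<le> 0"
      by (simp add: matrix_add_distrib cscale_mult B_def trace_add matrix_mul_assoc[symmetric])
    then have "Re (c * w) \<le> 0"
      using trace_mul_sym[of "rank_one v" B] by (simp add: trace_mult_rank_one w_def)
    \<comment> \<open>Maximality gives \<open>Re (c * w) \<le> 0\<close>, while this quantity is a
      positive multiple of \<open>norm w - Re w\<close>; hence the two are equal.\<close>
    moreover from zw have "c * w = (of_real (norm w) - w) / of_real ((norm v)\<^sup>2)"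
      unfolding c_def by (simp add: field_simps)
    then have "Re (c * w) = (norm w - Re w) / (norm v)\<^sup>2" by (simp only: Re_divide_of_real) simp
    ultimately have "norm w \<le> Re w" using v by (simp add: divide_le_0_iff del: times_complex.sel)
    then have re: "Re w = norm w" using complex_Re_le_cmod[of w] by linarith
    then have "Im w = 0" using cmod_power2[of w] by simp
    then show ?thesis using re by (simp add: complex_eq_iff w_def)
  qed simp
  have "pos_semidef B"
    using key by (intro pos_semidefI_herm) (metis Im_complex_of_real, metis Re_complex_of_real norm_ge_zero)
  then show thesis using that U by (simp add: B_def)
qed

text \<open>Cauchy-Schwarz for the semidefinite form of \<open>B\<close>, applied to
  \<open>v\<close> and the \<open>i\<close>-th basis vector: the form is nonnegative at
  \<open>v + axis i c\<close> for every \<open>c\<close>, and a good choice of \<open>c\<close>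
  gives the bound.\<close>

lemma psd_entry_cauchy_schwarz:
  fixes B :: "complex ^ 'a::finite ^ 'a"
  assumes "pos_semidef B"
  shows "(norm ((B *v v) $ i))\<^sup>2 \<le> Re (B $ i $ i) * (v \<bullet> (B *v v))" and "0 \<le> Re (B $ i $ i)"
proof -
  define q b w where "q = v \<bullet> (B *v v)" and "b = Re (B $ i $ i)" and "w = (B *v v) $ i"
  have ax: "(B *v axis i c) $ i = B $ i $ i * c" for c
    by (simp add: matrix_vector_mult_def axis_def if_distrib cong: if_cong)
  have axq: "axis i c \<bullet> (B *v axis i c) = (norm c)\<^sup>2 * b" for c
    unfolding cmod_power2
    by (simp add: inner_axis' ax inner_complex_Re b_def algebra_simps power2_eq_square)
  have nn: "0 \<le> u \<bullet> (B *v u)" for u using assms by (simp add: pos_semidef_def)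
  show b: "0 \<le> Re (B $ i $ i)" using nn[of "axis i 1"] axq[of 1] by (simp add: b_def)
  have q: "0 \<le> q" using nn by (simp add: q_def)
  have sw: "v \<bullet> (B *v axis i c) = w \<bullet> c" for c
    using adj_inner[of v B "axis i c"] psd_selfadjoint[OF assms] by (simp add: inner_axis w_def)
  have expand: "0 \<le> q + 2 * (w \<bullet> c) + (norm c)\<^sup>2 * b" for c
    using nn[of "v + axis i c"] sw[of c] axq[of c]
    by (simp add: matrix_vector_right_distrib inner_add_left inner_add_right q_def inner_axis'
        w_def[symmetric] inner_commute)
  have ineq: "0 \<le> q - 2 * x * (norm w)\<^sup>2 + x\<^sup>2 * (norm w)\<^sup>2 * b" for x
    using expand[of "- (x *\<^sub>R w)"] by (simp add: power2_norm_eq_inner power_mult_distrib)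
  have "(norm w)\<^sup>2 \<le> b * q"
  proof (cases "b = 0")
    case True
    have "w = 0"
    proof (rule ccontr)
      assume "w \<noteq> 0"
      \<comment> \<open>For \<open>b = 0\<close> the bound is affine in \<open>x\<close>, and this
        \<open>x\<close> gives it the value \<open>- q - 2 < 0\<close>.\<close>
      then show False using ineq[of "(q + 1) / (norm w)\<^sup>2"] q True by simp
    qed
    then show ?thesis using True by simp
  next
    case False
    then have "b > 0" using b by (simp add: b_def)
    \<comment> \<open>\<open>x = 1 / b\<close> minimises the quadratic when \<open>w\<close> is
      nonzero.\<close>
    then show ?thesis using ineq[of "1 / b"] by (simp add: field_simps power2_eq_square)
  qed
  then show "(norm ((B *v v) $ i))\<^sup>2 \<le> Re (B $ i $ i) * (v \<bullet> (B *v v))"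
    by (simp add: w_def b_def q_def)
qed

section \<open>Uniqueness of the positive square root\<close>

lemma psd_kernel: "pos_semidef B \<Longrightarrow> v \<bullet> (B *v v) = 0 \<Longrightarrow> B *v v = 0"
  for B :: "complex ^ 'a::finite ^ 'a"
  using psd_entry_cauchy_schwarz(1)[of B v] by (simp add: vec_eq_iff)

text \<open>With \<open>D = B - C\<close> and \<open>S = B + C\<close>, equal squares make
  \<open>S\<close> and \<open>D\<close> anticommute, so \<open>D ** S ** D\<close> has trace zero.
  Its diagonal entries are values of the form of \<open>S\<close> at the columns of
  \<open>D\<close>, hence nonnegative, hence zero. So \<open>B\<close> and \<open>C\<close> both
  kill the columns of \<open>D\<close>, and \<open>D ** D = 0\<close> with \<open>D\<close>
  self-adjoint gives \<open>D = 0\<close>.\<close>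

lemma psd_sqrt_unique:
  fixes B C :: "complex ^ 'a::finite ^ 'a"
  assumes B: "pos_semidef B" and C: "pos_semidef C" and eq: "B ** B = C ** C"
  shows "B = C"
proof -
  define D S where "D = B - C" and "S = B + C"
  have aD: "adj D = D" using psd_selfadjoint[OF B] psd_selfadjoint[OF C] by (simp add: D_def)
  have anti: "S ** D = - (D ** S)"
    using eq by (simp add: S_def D_def matrix_diff_distrib matrix_add_distrib)
  have "trace (D ** (S ** D)) = trace ((S ** D) ** D)" by (rule trace_mul_sym)
  also have "\<dots> = trace (- (D ** (S ** D)))"
    by (simp add: anti matrix_mul_assoc[symmetric] matrix_minus_mult)
  also have "\<dots> = - trace (D ** (S ** D))" by (simp add: trace_def sum_negf)
  finally have tr0: "trace (D ** (S ** D)) = 0" by simp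
  have diag: "Re (M $ i $ i) = axis i 1 \<bullet> (M *v axis i 1)" for M :: "complex ^ 'a ^ 'a" and i
    unfolding inner_axis'
    by (simp add: matrix_vector_mult_def axis_def inner_complex_Re if_distrib cong: if_cong)
  have diagD: "Re ((D ** (M ** D)) $ i $ i) = (D *v axis i 1) \<bullet> (M *v (D *v axis i 1))"
    for M :: "complex ^ 'a ^ 'a" and i
    by (simp add: diag matrix_vector_mul_assoc[symmetric] adj_inner[of "axis i 1" D] aD)
  have nn: "0 \<le> u \<bullet> (B *v u)" "0 \<le> u \<bullet> (C *v u)" for u
    using B C by (simp_all add: pos_semidef_def)
  have "(\<Sum>i\<in>UNIV. Re ((D ** (S ** D)) $ i $ i)) = 0"
    using tr0 by (simp add: trace_def Re_sum[symmetric] del: Re_sum)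
  then have "(\<Sum>i\<in>UNIV. (D *v axis i 1) \<bullet> (S *v (D *v axis i 1))) = 0"
    by (simp add: diagD)
  \<comment> \<open>A vanishing sum of nonnegative terms vanishes termwise.\<close>
  then have "(D *v axis i 1) \<bullet> (S *v (D *v axis i 1)) = 0" for i
    using nn by (subst (asm) sum_nonneg_eq_0_iff)
      (auto simp: S_def matrix_vector_mult_add_rdistrib inner_add_right add_nonneg_nonneg)
  then have "(D *v axis i 1) \<bullet> (B *v (D *v axis i 1)) + (D *v axis i 1) \<bullet> (C *v (D *v axis i 1)) = 0" for i
    by (simp add: S_def matrix_vector_mult_add_rdistrib inner_add_right)
  then have "(D *v axis i 1) \<bullet> (B *v (D *v axis i 1)) = 0" "(D *v axis i 1) \<bullet> (C *v (D *v axis i 1)) = 0" for i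
    using nn[of "D *v axis i 1"] by (metis add_nonneg_eq_0_iff)+
  then have "B *v (D *v axis i 1) = 0" "C *v (D *v axis i 1) = 0" for i
    using psd_kernel B C by blast+
  then have "D *v (D *v axis i 1) = 0" for i
    by (simp add: D_def matrix_vector_mult_diff_rdistrib)
  then have "(D *v axis i 1) \<bullet> (D *v axis i 1) = 0" for i
    by (metis aD adj_inner inner_zero_right)
  then have "D *v axis i 1 = 0" for i by simp
  then have "D $ j $ i = 0" for i j
    by (simp add: matrix_vector_mult_def axis_def vec_eq_iff if_distrib cong: if_cong)
  then have "D = 0" by (simp add: vec_eq_iff)
  then show ?thesis by (simp add: D_def)
qed

text \<open>The positive polar factor squares to \<open>adj A ** A\<close>, and uniqueness of the
  square root resolves the definite description in \<open>mat_abs\<close>.\<close>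

lemma mat_abs_eq:
  fixes A :: "complex ^ 'a::finite ^ 'a"
  assumes "unitary U" "pos_semidef (U ** A)"
  shows "mat_abs A = U ** A"
proof -
  have sq: "(U ** A) ** (U ** A) = adj A ** A"
  proof -
    have "(U ** A) ** (U ** A) = adj (U ** A) ** (U ** A)" by (simp only: psd_selfadjoint[OF assms(2)])
    also have "\<dots> = adj A ** (adj U ** U) ** A" by (simp add: matrix_mul_assoc)
    also have "\<dots> = adj A ** A" using assms(1) by (simp add: unitary_def)
    finally show ?thesis .
  qed
  show ?thesis unfolding mat_abs_def
  proof (rule the_equality)
    show "B = U ** A" if "pos_semidef B \<and> B ** B = adj A ** A" for B
      by (rule psd_sqrt_unique) (use that assms(2) sq in auto)
  qed (use sq assms(2) in blast)
qed

text \<open>Induction along the Cholesky decomposition.\<close>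
lemma psd_induct [consumes 1, case_names zero add_rank_one]:
  fixes B :: "complex ^ 'a::finite ^ 'a"
  assumes "pos_semidef B" and zero: "P 0"
    and step: "\<And>B v. P B \<Longrightarrow> P (B + rank_one v)"
  shows "P B"
  using assms(1)
\<comment> \<open>Each step clears at least one nonzero diagonal entry.\<close>
proof (induction "card {i. Re (B $ i $ i) \<noteq> 0}" arbitrary: B rule: less_induct)
  case less
  have psd: "pos_semidef B" by fact
  have sa: "cnj (B $ k $ j) = B $ j $ k" for j k
    using psd_selfadjoint[OF psd] by (metis adj_nth)
  show ?case
  proof (cases "\<exists>i. Re (B $ i $ i) \<noteq> 0")
    case False
    \<comment> \<open>By Cauchy-Schwarz a zero diagonal makes every coordinate of
      \<open>B *v v\<close> vanish.\<close>
    then have "B *v v = 0 *v v" for v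
      using psd_entry_cauchy_schwarz(1)[OF psd, of v] by (simp add: vec_eq_iff)
    then have "B = 0" by (metis matrix_eq)
    then show ?thesis using zero by simp
  next
    case True
    then obtain i where i: "Re (B $ i $ i) \<noteq> 0" by blast
    \<comment> \<open>\<open>u\<close> is the \<open>i\<close>-th column scaled so that
      \<open>rank_one u\<close> agrees with \<open>B\<close> on row and column
      \<open>i\<close>.\<close>
    define b u where "b = Re (B $ i $ i)" and "u = (\<chi> k. B $ k $ i / of_real (sqrt b))"
    have b: "b > 0" using i psd_entry_cauchy_schwarz(2)[OF psd, of i] by (simp add: b_def)
    have hu: "herm u v = (B *v v) $ i / of_real (sqrt b)" for v
      by (simp add: herm_def u_def sa matrix_vector_mult_def sum_divide_distrib)
    have q: "v \<bullet> (rank_one u *v v) = (norm ((B *v v) $ i))\<^sup>2 / b" for v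
    proof -
      have "herm v (herm u v *s u) = herm u v * herm v u"
        unfolding herm_def[of v] by (simp add: sum_distrib_left mult_ac)
      also have "herm v u = cnj (herm u v)"
        by (simp add: herm_def mult_ac)
      finally have "herm v (herm u v *s u) = herm u v * cnj (herm u v)" .
      then have "v \<bullet> (rank_one u *v v) = Re (herm u v * cnj (herm u v))"
        unfolding rank_one_mult_vec Re_herm[symmetric] by (simp only:)
      also have "\<dots> = (norm (herm u v))\<^sup>2"
        by (simp add: complex_norm_square[symmetric])
      finally show ?thesis using b by (simp add: hu norm_divide power_divide)
    qed
    \<comment> \<open>By \<open>q\<close>, Cauchy-Schwarz says precisely that the form of
      \<open>rank_one u\<close> is at most that of \<open>B\<close>.\<close>
    define B' where "B' = B - rank_one u"
    have psd': "pos_semidef B'"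
      unfolding pos_semidef_def selfadjoint_def
    proof (intro conjI allI)
      show "adj B' = B'" using psd_selfadjoint[OF psd] by (simp add: B'_def)
      show "0 \<le> v \<bullet> (B' *v v)" for v
        using psd_entry_cauchy_schwarz(1)[OF psd, of v i] b
        by (simp add: B'_def matrix_vector_mult_diff_rdistrib inner_diff_right q b_def[symmetric]
            field_simps)
    qed
    have "{j. Re (B' $ j $ j) \<noteq> 0} \<subset> {j. Re (B $ j $ j) \<noteq> 0}"
    proof (rule psubsetI)
      \<comment> \<open>Diagonal entries only decrease but stay nonnegative, so zeros persist, and
        entry \<open>i\<close> becomes a new zero.\<close>
      have le: "Re (B' $ j $ j) \<le> Re (B $ j $ j)" for j
        by (simp add: B'_def rank_one_def)
      have "Re (B' $ j $ j) = 0" if "Re (B $ j $ j) = 0" for j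
        using le[of j] that psd_entry_cauchy_schwarz(2)[OF psd', of j] by simp
      then show "{j. Re (B' $ j $ j) \<noteq> 0} \<subseteq> {j. Re (B $ j $ j) \<noteq> 0}" by blast
      have Bii: "B $ i $ i = of_real b" using sa[of i i] by (simp add: b_def complex_eq_iff)
      have "B' $ i $ i = 0"
        using b by (simp add: B'_def rank_one_def u_def Bii field_simps flip: of_real_mult)
      then show "{j. Re (B' $ j $ j) \<noteq> 0} \<noteq> {j. Re (B $ j $ j) \<noteq> 0}" using i by (metis (mono_tags, lifting) mem_Collect_eq zero_complex.sel(1))
    qed
    then have "card {j. Re (B' $ j $ j) \<noteq> 0} < card {j. Re (B $ j $ j) \<noteq> 0}"
      by (rule psubset_card_mono[rotated]) simp
    from less.hyps[OF this psd'] have "P (B' + rank_one u)" by (rule step)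
    then show ?thesis by (simp add: B'_def)
  qed
qed

text \<open>Both sides are additive in \<open>B\<close>, so rank-one matrices suffice; there the
  claim is Cauchy-Schwarz for \<open>v\<close> and \<open>Q *v v\<close>.\<close>

lemma trace_psd_bound:
  fixes B Q :: "complex ^ 'a::finite ^ 'a"
  assumes "pos_semidef B"
  shows "Re (trace (Q ** B)) \<le> op_norm Q * Re (trace B)"
  using assms
proof (induction rule: psd_induct)
  case zero
  then show ?case by (simp add: trace_def)
next
  case (add_rank_one B v)
  have "Re (trace (Q ** rank_one v)) = v \<bullet> (Q *v v)" by (simp add: trace_mult_rank_one Re_herm)
  also have "\<dots> \<le> norm v * norm (Q *v v)" by (rule norm_cauchy_schwarz)
  also have "\<dots> \<le> norm v * (op_norm Q * norm v)" by (intro mult_left_mono op_norm_bound) simp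
  also have "\<dots> = op_norm Q * Re (trace (rank_one v))"
    using trace_mult_rank_one[of "mat 1" v] by (simp add: herm_self power2_eq_square)
  finally show ?case using add_rank_one by (simp add: matrix_add_distrib trace_add algebra_simps)
qed

section \<open>The trace norm\<close>

text \<open>The unnormalised version of \<open>norm1\<close>, for any index type; the factor
  \<open>2 ^ CARD('n)\<close> is restored only at the end.\<close>

definition trace_norm :: "complex ^ 'a ^ 'a \<Rightarrow> real" where
  "trace_norm A = Re (trace (mat_abs A))"

text \<open>Inserting \<open>adj U ** U\<close> replaces \<open>A\<close> by its positive factor
  \<open>U ** A\<close> and \<open>Q\<close> by \<open>Q ** adj U\<close>, whose operator norm is no
  larger.\<close>

lemma trace_norm_dual: "Re (trace (Q ** A)) \<le> op_norm Q * trace_norm A"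
  for A Q :: "complex ^ 'a::finite ^ 'a"
proof -
  obtain U where U: "unitary U" "pos_semidef (U ** A)" by (rule polar_decomposition)
  have "Q ** A = Q ** (adj U ** U) ** A" using U(1) by (simp add: unitary_def)
  then have "Re (trace (Q ** A)) = Re (trace ((Q ** adj U) ** (U ** A)))"
    by (simp add: matrix_mul_assoc)
  also have "\<dots> \<le> op_norm (Q ** adj U) * Re (trace (U ** A))" by (rule trace_psd_bound[OF U(2)])
  also have "\<dots> \<le> op_norm Q * Re (trace (U ** A))"
  proof (rule mult_right_mono)
    have "op_norm (Q ** adj U) \<le> op_norm Q * op_norm (adj U)" by (rule op_norm_mult)
    also have "\<dots> \<le> op_norm Q * 1"
      by (intro mult_left_mono op_norm_unitary unitary_adj U op_norm_nonneg)
    finally show "op_norm (Q ** adj U) \<le> op_norm Q" by simp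
    show "0 \<le> Re (trace (U ** A))"
      by (simp add: trace_def sum_nonneg psd_entry_cauchy_schwarz(2)[OF U(2)])
  qed
  finally show ?thesis by (simp add: trace_norm_def mat_abs_eq[OF U])
qed

text \<open>The polar unitary is a contraction that attains the dual bound. Together with
  \<open>trace_norm_dual\<close> this reduces each norm inequality to an estimate of one
  trace.\<close>

lemma trace_norm_leI:
  fixes A :: "complex ^ 'a::finite ^ 'a"
  assumes "\<And>Q. op_norm Q \<le> 1 \<Longrightarrow> Re (trace (Q ** A)) \<le> c"
  shows "trace_norm A \<le> c"
proof -
  obtain U where U: "unitary U" "pos_semidef (U ** A)" by (rule polar_decomposition)
  show ?thesis using assms[OF op_norm_unitary[OF U(1)]] by (simp add: trace_norm_def mat_abs_eq[OF U])
qed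

lemma trace_norm_nonneg: "0 \<le> trace_norm A"
  for A :: "complex ^ 'a::finite ^ 'a"
proof -
  obtain U where U: "unitary U" "pos_semidef (U ** A)" by (rule polar_decomposition)
  show ?thesis
    by (simp add: trace_norm_def mat_abs_eq[OF U] trace_def sum_nonneg psd_entry_cauchy_schwarz(2)[OF U(2)])
qed

lemma trace_norm_dual_contraction: "op_norm Q \<le> 1 \<Longrightarrow> Re (trace (Q ** A)) \<le> trace_norm A"
  for A Q :: "complex ^ 'a::finite ^ 'a"
  using trace_norm_dual[of Q A] mult_right_mono[of "op_norm Q" 1, OF _ trace_norm_nonneg[of A]]
  by simp

lemma trace_norm_add: "trace_norm (A + B) \<le> trace_norm A + trace_norm B"
  for A B :: "complex ^ 'a::finite ^ 'a"
proof (rule trace_norm_leI)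
  fix Q :: "complex ^ 'a ^ 'a" assume "op_norm Q \<le> 1"
  then show "Re (trace (Q ** (A + B))) \<le> trace_norm A + trace_norm B"
    using trace_norm_dual_contraction[of Q A] trace_norm_dual_contraction[of Q B]
    by (simp add: matrix_add_distrib trace_add)
qed

lemma trace_norm_cscale: "trace_norm (c *\<^sub>c A) \<le> norm c * trace_norm A"
  for A :: "complex ^ 'a::finite ^ 'a"
proof (rule trace_norm_leI)
  fix Q :: "complex ^ 'a ^ 'a" assume Q: "op_norm Q \<le> 1"
  have "Re (trace (Q ** (c *\<^sub>c A))) = Re (trace ((c *\<^sub>c Q) ** A))" by (simp add: cscale_mult)
  also have "\<dots> \<le> op_norm (c *\<^sub>c Q) * trace_norm A" by (rule trace_norm_dual)
  also have "\<dots> \<le> (norm c * 1) * trace_norm A"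
    by (intro mult_right_mono order_trans[OF op_norm_cscale] mult_left_mono Q trace_norm_nonneg) simp
  finally show "Re (trace (Q ** (c *\<^sub>c A))) \<le> norm c * trace_norm A" by simp
qed

lemma trace_norm_scaleR: "trace_norm (r *\<^sub>R A) \<le> \<bar>r\<bar> * trace_norm A"
  for A :: "complex ^ 'a::finite ^ 'a"
  using trace_norm_cscale[of "of_real r" A] by (simp add: scaleR_eq_cscale)

lemma trace_norm_minus: "trace_norm (- A) = trace_norm A"
  for A :: "complex ^ 'a::finite ^ 'a"
  using trace_norm_scaleR[of "-1" A] trace_norm_scaleR[of "-1" "- A"] by simp

lemma trace_norm_zero: "trace_norm (0 :: complex ^ 'a::finite ^ 'a) = 0"
  using trace_norm_scaleR[of 0 "0 :: complex ^ 'a ^ 'a"] trace_norm_nonneg[of "0 :: complex ^ 'a ^ 'a"]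
  by simp

lemma trace_norm_diff: "trace_norm (A - B) \<le> trace_norm A + trace_norm B"
  for A B :: "complex ^ 'a::finite ^ 'a"
  using trace_norm_add[of A "- B"] by (simp add: trace_norm_minus)

lemma trace_norm_diff_abs: "\<bar>trace_norm A - trace_norm B\<bar> \<le> trace_norm (A - B)"
  for A B :: "complex ^ 'a::finite ^ 'a"
  using trace_norm_add[of "A - B" B] trace_norm_add[of "B - A" A] trace_norm_minus[of "A - B"] by simp

lemma trace_norm_sum: "trace_norm (\<Sum>i\<in>I. f i) \<le> (\<Sum>i\<in>I. trace_norm (f i))"
  for f :: "'i \<Rightarrow> complex ^ 'a::finite ^ 'a"
proof (induction I rule: infinite_finite_induct)
  case (insert i I)
  then show ?case using trace_norm_add[of "f i" "sum f I"] by simp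
qed (simp_all add: trace_norm_zero)

lemma trace_norm_mult_left: "trace_norm (M ** A) \<le> op_norm M * trace_norm A"
  for A M :: "complex ^ 'a::finite ^ 'a"
proof (rule trace_norm_leI)
  fix Q :: "complex ^ 'a ^ 'a" assume Q: "op_norm Q \<le> 1"
  have "Re (trace (Q ** (M ** A))) \<le> op_norm (Q ** M) * trace_norm A"
    unfolding matrix_mul_assoc by (rule trace_norm_dual)
  also have "\<dots> \<le> (1 * op_norm M) * trace_norm A"
    by (intro mult_right_mono order_trans[OF op_norm_mult] Q trace_norm_nonneg op_norm_nonneg)
  finally show "Re (trace (Q ** (M ** A))) \<le> op_norm M * trace_norm A" by simp
qed

lemma trace_norm_mult_right: "trace_norm (A ** M) \<le> op_norm M * trace_norm A"
  for A M :: "complex ^ 'a::finite ^ 'a"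
proof (rule trace_norm_leI)
  fix Q :: "complex ^ 'a ^ 'a" assume Q: "op_norm Q \<le> 1"
  have "trace (Q ** (A ** M)) = trace ((M ** Q) ** A)"
    by (metis matrix_mul_assoc trace_mul_sym)
  then have "Re (trace (Q ** (A ** M))) \<le> op_norm (M ** Q) * trace_norm A"
    by (simp add: trace_norm_dual)
  also have "\<dots> \<le> (op_norm M * 1) * trace_norm A"
    by (intro mult_right_mono order_trans[OF op_norm_mult] mult_left_mono Q trace_norm_nonneg
        op_norm_nonneg)
  finally show "Re (trace (Q ** (A ** M))) \<le> op_norm M * trace_norm A" by simp
qed

lemma trace_norm_commutator:
  "trace_norm (h ** A - A ** h) \<le> 2 * op_norm h * trace_norm A"
  for A h :: "complex ^ 'a::finite ^ 'a"
  using trace_norm_diff[of "h ** A" "A ** h"] trace_norm_mult_left[of h A] trace_norm_mult_right[of A h]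
  by simp

text \<open>A crude comparison, bounding every entry product in the trace separately. It serves to
  turn differentiability remainders, small in the library norm, into remainders small in the trace
  norm.\<close>

lemma trace_norm_le_norm: "trace_norm A \<le> (real CARD('a))\<^sup>2 * norm A"
  for A :: "complex ^ 'a::finite ^ 'a"
proof (rule trace_norm_leI)
  fix Q :: "complex ^ 'a ^ 'a" assume Q: "op_norm Q \<le> 1"
  have entry: "Re (Q $ i $ j * A $ j $ i) \<le> norm A" for i j
  proof -
    have "Re (Q $ i $ j * A $ j $ i) \<le> norm (Q $ i $ j) * norm (A $ j $ i)"
      using complex_Re_le_cmod[of "Q $ i $ j * A $ j $ i"] by (simp add: norm_mult)
    also have "\<dots> \<le> 1 * norm A"
      by (intro mult_mono order_trans[OF norm_entry_le_op_norm Q]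
          order_trans[OF Finite_Cartesian_Product.norm_nth_le Finite_Cartesian_Product.norm_nth_le]) auto
    finally show ?thesis by simp
  qed
  have "Re (trace (Q ** A)) = (\<Sum>i\<in>UNIV. \<Sum>j\<in>UNIV. Re (Q $ i $ j * A $ j $ i))"
    by (simp add: trace_def matrix_matrix_mult_def)
  also have "\<dots> \<le> (\<Sum>i\<in>(UNIV::'a set). \<Sum>j\<in>(UNIV::'a set). norm A)"
    by (intro sum_mono entry)
  finally show "Re (trace (Q ** A)) \<le> (real CARD('a))\<^sup>2 * norm A"
    by (simp add: power2_eq_square mult.assoc)
qed

section \<open>Variation of the trace norm along a differentiable curve\<close>

text \<open>For self-adjoint \<open>K\<close> the vectors \<open>v\<close> and
  \<open>\<i> *s (K *v v)\<close> are orthogonal in the real inner product, so by Pythagoras the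
  norm grows only to second order in \<open>t\<close>.\<close>

lemma op_norm_one_plus_skew:
  fixes K :: "complex ^ 'a::finite ^ 'a"
  assumes "adj K = K"
  shows "op_norm (mat 1 + (\<i> * of_real t) *\<^sub>c K) \<le> sqrt (1 + t\<^sup>2 * (op_norm K)\<^sup>2)"
proof (rule op_norm_le)
  fix v :: "complex ^ 'a"
  define w where "w = t *\<^sub>R (K *v v)"
  have "(\<i> *s v) \<bullet> (K *v v) = (K *v (\<i> *s v)) \<bullet> v"
    by (metis adj_inner assms)
  also have "\<dots> = - ((\<i> *s v) \<bullet> (K *v v))"
    by (simp add: vector_scalar_commute i_inner inner_commute[of "K *v v"])
  finally have "(\<i> *s v) \<bullet> (K *v v) = 0" by simp
  then have orth: "v \<bullet> (\<i> *s (K *v v)) = 0" by (simp add: i_inner)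
  have Av: "(mat 1 + (\<i> * of_real t) *\<^sub>c K) *v v = v + \<i> *s w"
    by (simp add: matrix_vector_mult_add_rdistrib cscale_mult_vec w_def vec_eq_iff)
      (simp add: scaleR_conv_of_real)
  have vw: "v \<bullet> (\<i> *s w) = 0"
  proof -
    have "\<i> *s w = t *\<^sub>R (\<i> *s (K *v v))" by (simp add: w_def vec_eq_iff)
    then show ?thesis using orth by simp
  qed
  have "(norm (v + \<i> *s w))\<^sup>2 = (norm v)\<^sup>2 + (norm (\<i> *s w))\<^sup>2"
    using vw by (simp add: power2_norm_eq_inner inner_add_left inner_add_right inner_commute)
  also have "norm (\<i> *s w) = \<bar>t\<bar> * norm (K *v v)" by (simp add: norm_scalar_vec w_def)
  also have "(norm v)\<^sup>2 + (\<bar>t\<bar> * norm (K *v v))\<^sup>2 \<le> (norm v)\<^sup>2 + (\<bar>t\<bar> * (op_norm K * norm v))\<^sup>2"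
    by (intro add_left_mono power_mono mult_left_mono op_norm_bound) auto
  also have "\<dots> = (sqrt (1 + t\<^sup>2 * (op_norm K)\<^sup>2) * norm v)\<^sup>2"
    by (simp add: power_mult_distrib algebra_simps)
  finally show "norm ((mat 1 + (\<i> * of_real t) *\<^sub>c K) *v v) \<le> sqrt (1 + t\<^sup>2 * (op_norm K)\<^sup>2) * norm v"
    unfolding Av by (rule power2_le_imp_le) simp
qed simp

text \<open>To first order in \<open>t\<close>, the matrix \<open>X - \<i> t [K, X]\<close> is the conjugate of \<open>X\<close> by \<open>1 - \<i> t K\<close>,
  whose norm is \<open>1 + O(t\<^sup>2)\<close>. The lower bound follows from the upper one by convexity.\<close>
lemma trace_norm_commutator_flow:
  fixes K X :: "complex ^ 'a::finite ^ 'a"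
  assumes K: "adj K = K" and Y: "Y = (- \<i>) *\<^sub>c (K ** X - X ** K)"
  shows "\<bar>trace_norm (X + t *\<^sub>R Y) - trace_norm X\<bar> \<le> 2 * t\<^sup>2 * (op_norm K)\<^sup>2 * trace_norm X"
proof -
  have upper: "trace_norm (X + t *\<^sub>R Y) \<le> (1 + 2 * t\<^sup>2 * (op_norm K)\<^sup>2) * trace_norm X" for t
  proof -
    define A where "A t = mat 1 + (\<i> * of_real t) *\<^sub>c K" for t
    have "A (- t) ** X ** A t = X + t *\<^sub>R Y + t\<^sup>2 *\<^sub>R (K ** X ** K)"
      unfolding A_def Y scaleR_eq_cscale
      by (simp add: matrix_add_distrib matrix_diff_distrib cscale_mult cscale_simps matrix_mul_assoc
          power2_eq_square mult_ac add_ac)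
    then have eq: "X + t *\<^sub>R Y = A (- t) ** X ** A t - t\<^sup>2 *\<^sub>R (K ** X ** K)" by simp
    have nA: "op_norm (A s) \<le> sqrt (1 + s\<^sup>2 * (op_norm K)\<^sup>2)" for s
      unfolding A_def by (rule op_norm_one_plus_skew[OF K])
    have "trace_norm (A (- t) ** X ** A t) \<le> op_norm (A t) * (op_norm (A (- t)) * trace_norm X)"
      by (intro order_trans[OF trace_norm_mult_right] mult_left_mono trace_norm_mult_left op_norm_nonneg)
    also have "\<dots> = op_norm (A t) * op_norm (A (- t)) * trace_norm X" by simp
    also have "\<dots> \<le> (sqrt (1 + t\<^sup>2 * (op_norm K)\<^sup>2) * sqrt (1 + t\<^sup>2 * (op_norm K)\<^sup>2)) * trace_norm X"
      using nA[of t] nA[of "- t"]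
      by (intro mult_right_mono mult_mono trace_norm_nonneg op_norm_nonneg) auto
    finally have 1: "trace_norm (A (- t) ** X ** A t) \<le> (1 + t\<^sup>2 * (op_norm K)\<^sup>2) * trace_norm X"
      by simp
    \<comment> \<open>The conjugation and this correction each cost
      \<open>t\<^sup>2 * (op_norm K)\<^sup>2 * trace_norm X\<close>, whence the factor 2.\<close>
    have "trace_norm (t\<^sup>2 *\<^sub>R (K ** X ** K)) \<le> t\<^sup>2 * trace_norm (K ** X ** K)"
      using trace_norm_scaleR[of "t\<^sup>2"] by simp
    also have "\<dots> \<le> t\<^sup>2 * (op_norm K * (op_norm K * trace_norm X))"
      by (intro order_trans[OF trace_norm_mult_right] mult_left_mono trace_norm_mult_left
          op_norm_nonneg) simp
    finally show ?thesis
      using 1 trace_norm_diff[of "A (- t) ** X ** A t" "t\<^sup>2 *\<^sub>R (K ** X ** K)"]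
      unfolding eq by (simp add: algebra_simps power2_eq_square)
  qed
  \<comment> \<open>\<open>X\<close> is the midpoint of \<open>X + t *\<^sub>R Y\<close> and
    \<open>X - t *\<^sub>R Y\<close>; the upper bound at \<open>- t\<close> then gives the lower
    bound at \<open>t\<close>.\<close>
  have "2 * trace_norm X \<le> trace_norm (X + t *\<^sub>R Y) + trace_norm (X - t *\<^sub>R Y)"
  proof -
    have "X = (1 / 2) *\<^sub>R ((X + t *\<^sub>R Y) + (X - t *\<^sub>R Y))" by (simp flip: scaleR_2)
    then have "trace_norm X \<le> \<bar>1 / 2\<bar> * trace_norm ((X + t *\<^sub>R Y) + (X - t *\<^sub>R Y))"
      by (metis trace_norm_scaleR)
    then show ?thesis using trace_norm_add[of "X + t *\<^sub>R Y" "X - t *\<^sub>R Y"] by simp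
  qed
  then show ?thesis using upper[of t] upper[of "- t"] by (simp add: algebra_simps abs_le_iff)
qed

text \<open>The trace norm need not be differentiable along \<open>X\<close>, so its rate of change
  is stated through difference quotients. The commutator contributes at second order,
  \<open>R\<close> at rate \<open>trace_norm R\<close>, and the remainder is of lower order.\<close>

lemma trace_norm_variation:
  fixes X :: "real \<Rightarrow> complex ^ 'a::finite ^ 'a"
  assumes X: "(X has_vector_derivative (- \<i>) *\<^sub>c (K ** X s - X s ** K) + R) (at s within S)"
    and K: "adj K = K" and e: "e > 0"
  shows "\<exists>d>0. \<forall>t\<in>S. \<bar>t - s\<bar> < d \<longrightarrow> \<bar>trace_norm (X t) - trace_norm (X s)\<bar> \<le> (trace_norm R + e) * \<bar>t - s\<bar>"
proof -
  define Y where "Y = (- \<i>) *\<^sub>c (K ** X s - X s ** K)"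
  define c where "c = (real CARD('a))\<^sup>2"
  define k where "k = 2 * (op_norm K)\<^sup>2 * trace_norm (X s)"
  have c: "c > 0" by (simp add: c_def)
  have k: "k \<ge> 0" by (simp add: k_def trace_norm_nonneg)
  have "e / (2 * c) > 0" using e c by simp
  then obtain d where d: "d > 0"
    and dX: "\<And>t. t \<in> S \<Longrightarrow> \<bar>t - s\<bar> < d \<Longrightarrow>
      norm (X t - X s - (t - s) *\<^sub>R (Y + R)) \<le> e / (2 * c) * \<bar>t - s\<bar>"
    using X unfolding has_vector_derivative_def has_derivative_within_alt Y_def[symmetric]
    by (metis real_norm_def)
  \<comment> \<open>Chosen so that the second-order term is at most
    \<open>e / 2 * \<bar>t - s\<bar>\<close>; the \<open>+ 1\<close> covers
    \<open>k = 0\<close>.\<close>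
  define d' where "d' = e / (2 * (k + 1))"
  have d': "d' > 0" using e k by (simp add: d'_def)
  show ?thesis
  proof (intro exI[of _ "min d d'"] conjI ballI impI)
    fix t assume t: "t \<in> S" "\<bar>t - s\<bar> < min d d'"
    define E where "E = X t - X s - (t - s) *\<^sub>R (Y + R)"
    have "trace_norm E \<le> c * norm E" unfolding c_def by (rule trace_norm_le_norm)
    also have "\<dots> \<le> c * (e / (2 * c) * \<bar>t - s\<bar>)"
      using dX t c unfolding E_def by (intro mult_left_mono) auto
    also have "\<dots> = e / 2 * \<bar>t - s\<bar>" using c by simp
    finally have E: "trace_norm E \<le> e / 2 * \<bar>t - s\<bar>" .
    have "\<bar>trace_norm (X t) - trace_norm (X s + (t - s) *\<^sub>R Y)\<bar> \<le> trace_norm ((t - s) *\<^sub>R R + E)"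
      using trace_norm_diff_abs[of "X t" "X s + (t - s) *\<^sub>R Y"]
      by (simp add: E_def scaleR_add_right algebra_simps)
    also have "\<dots> \<le> \<bar>t - s\<bar> * trace_norm R + e / 2 * \<bar>t - s\<bar>"
      using trace_norm_add[of "(t - s) *\<^sub>R R" E] trace_norm_scaleR[of "t - s" R] E by simp
    finally have 1: "\<bar>trace_norm (X t) - trace_norm (X s + (t - s) *\<^sub>R Y)\<bar>
      \<le> \<bar>t - s\<bar> * trace_norm R + e / 2 * \<bar>t - s\<bar>" .
    have "\<bar>trace_norm (X s + (t - s) *\<^sub>R Y) - trace_norm (X s)\<bar> \<le> (\<bar>t - s\<bar> * k) * \<bar>t - s\<bar>"
      using trace_norm_commutator_flow[OF K Y_def, of "t - s"]
      by (simp add: k_def power2_eq_square mult_ac flip: abs_mult_self_eq[of "t - s"] del: abs_mult_self_eq)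
    also have "\<dots> \<le> e / 2 * \<bar>t - s\<bar>"
    proof (rule mult_right_mono)
      have "\<bar>t - s\<bar> * k \<le> d' * (k + 1)" using t k d' by (intro mult_mono) auto
      moreover have "d' * (k + 1) = e / 2" using k by (simp add: d'_def field_simps)
      ultimately show "\<bar>t - s\<bar> * k \<le> e / 2" by simp
    qed simp
    finally have 2: "\<bar>trace_norm (X s + (t - s) *\<^sub>R Y) - trace_norm (X s)\<bar> \<le> e / 2 * \<bar>t - s\<bar>" .
    have "(trace_norm R + e) * \<bar>t - s\<bar> = \<bar>t - s\<bar> * trace_norm R + e / 2 * \<bar>t - s\<bar> + e / 2 * \<bar>t - s\<bar>"
      by (simp add: field_simps)
    then show "\<bar>trace_norm (X t) - trace_norm (X s)\<bar> \<le> (trace_norm R + e) * \<bar>t - s\<bar>"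
      using 1 2 by linarith
  qed (use d d' in auto)
qed

text \<open>A mean value inequality for a possibly non-differentiable \<open>f\<close>: compare its
  increments with those of the primitive \<open>G\<close> of \<open>g\<close>, up to a slope
  \<open>e\<close>. The comparison is additive over adjacent intervals and holds on short intervals
  around each point, so Bolzano's bisection principle extends it to the whole interval.\<close>

lemma abs_increment_le_integral:
  fixes f g :: "real \<Rightarrow> real"
  assumes ab: "a \<le> b" and g: "continuous_on {a..b} g"
    and f: "\<And>s e. s \<in> {a..b} \<Longrightarrow> e > 0 \<Longrightarrow>
      \<exists>d>0. \<forall>t\<in>{a..b}. \<bar>t - s\<bar> < d \<longrightarrow> \<bar>f t - f s\<bar> \<le> (g s + e) * \<bar>t - s\<bar>"
  shows "\<bar>f b - f a\<bar> \<le> integral {a..b} g"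
proof -
  define G where "G u = integral {a..u} g" for u
  have G': "(G has_vector_derivative g s) (at s within {a..b})" if "s \<in> {a..b}" for s
    unfolding G_def by (rule integral_has_vector_derivative[OF g that])
  have bound: "\<bar>f b - f a\<bar> \<le> G b - G a + e * (b - a)" if e: "e > 0" for e
  proof -
    have "a \<le> a \<longrightarrow> b \<le> b \<longrightarrow> \<bar>f b - f a\<bar> \<le> G b - G a + e * (b - a)"
      using ab
    proof (induction rule: Bolzano[where P = "\<lambda>u v. a \<le> u \<longrightarrow> v \<le> b \<longrightarrow>
          \<bar>f v - f u\<bar> \<le> G v - G u + e * (v - u)"])
      case (trans u v w)
      then show ?case by (auto simp: algebra_simps)
    next
      case (local s)
      then have s: "s \<in> {a..b}" by simp
      obtain d1 where d1: "d1 > 0"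
        "\<And>t. t \<in> {a..b} \<Longrightarrow> \<bar>t - s\<bar> < d1 \<Longrightarrow> \<bar>f t - f s\<bar> \<le> (g s + e / 2) * \<bar>t - s\<bar>"
        using f[OF s, of "e / 2"] e by auto
      have e2: "e / 2 > 0" using e by simp
      obtain d2 where d2: "d2 > 0"
        "\<And>t. t \<in> {a..b} \<Longrightarrow> \<bar>t - s\<bar> < d2 \<Longrightarrow> \<bar>G t - G s - (t - s) * g s\<bar> \<le> e / 2 * \<bar>t - s\<bar>"
        using G'[OF s] e2 unfolding has_vector_derivative_def has_derivative_within_alt
        by (metis real_norm_def real_scaleR_def)
      show ?case
      proof (intro exI[of _ "min d1 d2"] conjI allI impI)
        fix u v assume uv: "u \<le> s \<and> s \<le> v \<and> v - u < min d1 d2" and "a \<le> u" "v \<le> b"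
        then have mem: "u \<in> {a..b}" "v \<in> {a..b}" by auto
        \<comment> \<open>On each side of \<open>s\<close>, half of the slack \<open>e\<close>
          absorbs the error of \<open>f\<close> and half that of \<open>G\<close>; these names make
          the remaining step linear.\<close>
        define p q x y where "p = (v - s) * g s" and "q = (s - u) * g s"
          and "x = e * (v - s)" and "y = e * (s - u)"
        have "\<bar>f v - f s\<bar> \<le> p + x / 2" "\<bar>f u - f s\<bar> \<le> q + y / 2"
          "\<bar>G v - G s - p\<bar> \<le> x / 2" "\<bar>G u - G s + q\<bar> \<le> y / 2"
          using d1(2)[OF mem(1)] d1(2)[OF mem(2)] d2(2)[OF mem(1)] d2(2)[OF mem(2)] uv
          by (auto simp: p_def q_def x_def y_def algebra_simps)
        moreover have "e * (v - u) = x + y" by (simp add: x_def y_def algebra_simps)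
        ultimately show "\<bar>f v - f u\<bar> \<le> G v - G u + e * (v - u)" by linarith
      qed (use d1 d2 in auto)
    qed
    then show ?thesis by simp
  qed
  have "\<bar>f b - f a\<bar> \<le> G b - G a"
  proof (rule field_le_epsilon)
    fix e :: real assume e: "e > 0"
    define e' where "e' = e / (b - a + 1)"
    have "e' > 0" using e ab by (simp add: e'_def)
    moreover have "e' * (b - a) \<le> e" using e ab by (simp add: e'_def pos_divide_le_eq)
    ultimately show "\<bar>f b - f a\<bar> \<le> G b - G a + e" using bound[of e'] by linarith
  qed
  then show ?thesis by (simp add: G_def)
qed

section \<open>The maps \<open>d\<^sub>j\<close>\<close>

text \<open>The sign is \<open>+ 1\<close> on \<open>True\<close>; an overall sign cancels under
  conjugation.\<close>

definition pauli_Z :: "'n \<Rightarrow> ('n::finite) op" where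
  "pauli_Z j = (\<chi> x y. if x = y then (if x j then 1 else - 1) else 0)"

definition pauli_X :: "'n \<Rightarrow> ('n::finite) op" where
  "pauli_X j = (\<chi> x y. if y = x(j := \<not> x j) then 1 else 0)"

lemma flip_eq_iff: "y = x(j := \<not> x j) \<longleftrightarrow> x = y(j := \<not> y j)"
proof -
  have "x = (x(j := \<not> x j))(j := \<not> (x(j := \<not> x j)) j)" for x :: "'a \<Rightarrow> bool" by simp
  then show ?thesis by metis
qed

lemma pauli_mult:
  "(pauli_Z j ** A) $ x $ y = (if x j then 1 else - 1) * A $ x $ y"
  "(A ** pauli_Z j) $ x $ y = (if y j then 1 else - 1) * A $ x $ y"
  "(pauli_X j ** A) $ x $ y = A $ (x(j := \<not> x j)) $ y"
  "(A ** pauli_X j) $ x $ y = A $ x $ (y(j := \<not> y j))"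
proof -
  have "(pauli_Z j ** A) $ x $ y = (\<Sum>k\<in>UNIV. if x = k then (if x j then 1 else - 1) * A $ x $ y else 0)"
    unfolding pauli_Z_def matrix_matrix_mult_def vec_lambda_beta by (rule sum.cong) auto
  then show "(pauli_Z j ** A) $ x $ y = (if x j then 1 else - 1) * A $ x $ y" by simp
  have "(A ** pauli_Z j) $ x $ y = (\<Sum>k\<in>UNIV. if k = y then (if y j then 1 else - 1) * A $ x $ y else 0)"
    unfolding pauli_Z_def matrix_matrix_mult_def vec_lambda_beta by (rule sum.cong) auto
  then show "(A ** pauli_Z j) $ x $ y = (if y j then 1 else - 1) * A $ x $ y" by simp
  have "(pauli_X j ** A) $ x $ y = (\<Sum>k\<in>UNIV. if k = x(j := \<not> x j) then A $ k $ y else 0)"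
    unfolding pauli_X_def matrix_matrix_mult_def vec_lambda_beta by (rule sum.cong) simp_all
  then show "(pauli_X j ** A) $ x $ y = A $ (x(j := \<not> x j)) $ y" by simp
  have "(A ** pauli_X j) $ x $ y = (\<Sum>k\<in>UNIV. if k = y(j := \<not> y j) then A $ x $ k else 0)"
    unfolding pauli_X_def matrix_matrix_mult_def vec_lambda_beta flip_eq_iff[of y]
    by (rule sum.cong) simp_all
  then show "(A ** pauli_X j) $ x $ y = A $ x $ (y(j := \<not> y j))" by simp
qed

lemma unitary_pauli: "unitary (pauli_Z j)" "unitary (pauli_X j)"
proof -
  have "adj (pauli_Z j) = pauli_Z j" by (auto simp: vec_eq_iff pauli_Z_def)
  moreover have "pauli_Z j ** pauli_Z j = mat 1"
    by (auto simp: vec_eq_iff pauli_mult) (auto simp: pauli_Z_def mat_def)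
  ultimately show "unitary (pauli_Z j)" by (simp add: unitary_def)
  have "adj (pauli_X j) = pauli_X j"
    unfolding vec_eq_iff
  proof (intro allI)
    show "adj (pauli_X j) $ x $ y = pauli_X j $ x $ y" for x y
      by (simp add: pauli_X_def flip_eq_iff[of x y])
  qed
  moreover have "pauli_X j ** pauli_X j = mat 1"
    by (auto simp: vec_eq_iff pauli_mult(3)) (auto simp: pauli_X_def mat_def)
  ultimately show "unitary (pauli_X j)" by (simp add: unitary_def)
qed

text \<open>Conjugation by \<open>Z\<^sub>j\<close> and \<open>X\<^sub>j\<close> generates the action of the Pauli group on qubit \<open>j\<close>, and
  averaging over it is the normalised partial trace.\<close>
lemma d_op_twirl:
  "d_op j A = A - (1 / 4) *\<^sub>R (A + pauli_Z j ** A ** pauli_Z j + pauli_X j ** A ** pauli_X j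
    + pauli_X j ** (pauli_Z j ** A ** pauli_Z j) ** pauli_X j)"
proof -
  have upd: "x(j := x j) = x" for x :: "'a \<Rightarrow> bool" by simp
  have sum: "(\<Sum>b\<in>UNIV. A $ (x(j := b)) $ (y(j := b)))
      = A $ x $ y + A $ (x(j := \<not> x j)) $ (y(j := \<not> y j))" if "x j = y j" for x y
    using that upd[of x] upd[of y] by (cases "x j") (simp_all add: UNIV_bool add.commute)
  have entry: "d_op j A $ x $ y = A $ x $ y - (if x j = y j
      then (A $ x $ y + A $ (x(j := \<not> x j)) $ (y(j := \<not> y j))) / 2 else 0)" for x y
    using sum[of x y] by (simp add: d_op_def)
  \<comment> \<open>Averaging with the \<open>Z\<close> conjugate removes the entries with
    \<open>x j \<noteq> y j\<close>; conjugation by \<open>X\<close> flips bit \<open>j\<close> in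
    both indices, which yields the partial trace.\<close>
  show ?thesis
    unfolding vec_eq_iff entry vector_minus_component vector_add_component vector_scaleR_component
      pauli_mult by (auto simp: scaleR_conv_of_real)
qed

lemma trace_norm_conj_unitary_le: "unitary U \<Longrightarrow> unitary V \<Longrightarrow> trace_norm (U ** A ** V) \<le> trace_norm A"
  for U V A :: "complex ^ 'a::finite ^ 'a"
proof -
  assume UV: "unitary U" "unitary V"
  have "trace_norm (U ** A ** V) \<le> op_norm V * (op_norm U * trace_norm A)"
    by (intro order_trans[OF trace_norm_mult_right] mult_left_mono trace_norm_mult_left op_norm_nonneg)
  also have "\<dots> \<le> 1 * (1 * trace_norm A)"
    by (intro mult_mono op_norm_unitary UV order_refl trace_norm_nonneg op_norm_nonneg
        mult_nonneg_nonneg) simp_all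
  finally show ?thesis by simp
qed

text \<open>One unit comes from the identity map, the other from an average of four unitary
  conjugates.\<close>

lemma trace_norm_d_op: "trace_norm (d_op j A) \<le> 2 * trace_norm A"
proof -
  let ?Z = "pauli_Z j" and ?X = "pauli_X j"
  let ?A1 = "?Z ** A ** ?Z" let ?A2 = "?X ** A ** ?X" let ?A3 = "?X ** ?A1 ** ?X"
  note le = trace_norm_conj_unitary_le unitary_pauli
  have 1: "trace_norm ?A1 \<le> trace_norm A" by (intro le)
  have 2: "trace_norm ?A2 \<le> trace_norm A" by (intro le)
  have 3: "trace_norm ?A3 \<le> trace_norm A" by (rule order_trans[OF _ 1]) (intro le)
  have "trace_norm (A + ?A1 + ?A2 + ?A3) \<le> 4 * trace_norm A"
    using 1 2 3 trace_norm_add[of "A + ?A1 + ?A2" ?A3] trace_norm_add[of "A + ?A1" ?A2]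
      trace_norm_add[of A ?A1] by linarith
  then have "trace_norm ((1 / 4) *\<^sub>R (A + ?A1 + ?A2 + ?A3)) \<le> trace_norm A"
    using trace_norm_scaleR[of "1 / 4" "A + ?A1 + ?A2 + ?A3"] by simp
  then show ?thesis
    unfolding d_op_twirl[of j A] using trace_norm_diff[of A "(1 / 4) *\<^sub>R (A + ?A1 + ?A2 + ?A3)"] by linarith
qed

section \<open>Linearity of \<open>d_op\<close> and operators acting off qubit
  \<open>j\<close>\<close>

lemma d_op_simps:
  "d_op j (A - B) = d_op j A - d_op j B" "d_op j (r *\<^sub>R A) = r *\<^sub>R d_op j A"
proof -
  have "d_op j A = d_op j (A - B) + d_op j B" unfolding d_op_linear(1)[symmetric] by simp
  then show "d_op j (A - B) = d_op j A - d_op j B" by simp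
  show "d_op j (r *\<^sub>R A) = r *\<^sub>R d_op j A" unfolding scaleR_eq_cscale by (rule d_op_linear)
qed

lemma bounded_linear_d_op: "bounded_linear (d_op j)"
  unfolding linear_conv_bounded_linear[symmetric]
  by (rule linearI) (simp_all add: d_op_linear(1) d_op_simps)

text \<open>Entries of \<open>h\<close> vanish unless the two indices agree at \<open>j\<close>,
  which gives commutation with \<open>Z\<close>; they do not depend on the common bit there, which
  gives commutation with \<open>X\<close>.\<close>

lemma supported_on_commute_pauli:
  assumes "supported_on S h" "j \<notin> S"
  shows "h ** pauli_Z j = pauli_Z j ** h" "h ** pauli_X j = pauli_X j ** h"
proof -
  obtain B where B: "\<And>x y. h $ x $ y =
      (if \<forall>k. k \<notin> S \<longrightarrow> x k = y k then B (restrict x S) (restrict y S) else 0)"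
    using assms(1) unfolding supported_on_def by blast
  have "h $ x $ y = 0" if "x j \<noteq> y j" for x y using that assms(2) by (auto simp: B)
  then show "h ** pauli_Z j = pauli_Z j ** h"
    by (auto simp: vec_eq_iff pauli_mult)
  have r: "restrict (x(j := b)) S = restrict x S" for x and b :: bool
    using assms(2) by (auto simp: restrict_def fun_eq_iff)
  have "(\<forall>k. k \<notin> S \<longrightarrow> x k = (y(j := \<not> y j)) k) \<longleftrightarrow> (\<forall>k. k \<notin> S \<longrightarrow> (x(j := \<not> x j)) k = y k)" for x y
    by (metis fun_upd_other fun_upd_same)
  then have "h $ x $ (y(j := \<not> y j)) = h $ (x(j := \<not> x j)) $ y" for x y
    unfolding B r by simp
  then show "h ** pauli_X j = pauli_X j ** h"
    unfolding vec_eq_iff pauli_mult by blast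
qed

text \<open>\<open>h\<close> can be pulled out of every conjugate in the twirl formula.\<close>

lemma d_op_mult_commuting:
  assumes Z: "h ** pauli_Z j = pauli_Z j ** h" and X: "h ** pauli_X j = pauli_X j ** h"
  shows "d_op j (h ** A) = h ** d_op j A" "d_op j (A ** h) = d_op j A ** h"
proof -
  have l: "P ** (h ** B) ** P = h ** (P ** B ** P)" and r: "P ** (B ** h) ** P = (P ** B ** P) ** h"
    if "h ** P = P ** h" for P B using that by (metis matrix_mul_assoc)+
  show "d_op j (h ** A) = h ** d_op j A"
    unfolding d_op_twirl l[OF Z] l[OF X]
    by (simp only: matrix_add_distrib matrix_diff_distrib matrix_scaleR_mult)
  show "d_op j (A ** h) = d_op j A ** h"
    unfolding d_op_twirl r[OF Z] r[OF X]
    by (simp only: matrix_add_distrib matrix_diff_distrib matrix_scaleR_mult)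
qed

section \<open>Evolution of the influence\<close>

lemma norm1_eq: "norm1 A = trace_norm A / 2 ^ CARD('n)" for A :: "('n::finite) op"
  by (simp add: norm1_def trace_norm_def)

lemma selfadjoint_sum_scaleR:
  "(\<And>k. k \<in> T \<Longrightarrow> selfadjoint (h k)) \<Longrightarrow> adj (\<Sum>k\<in>T. r k *\<^sub>R h k) = (\<Sum>k\<in>T. r k *\<^sub>R h k)"
  by (induction T rule: infinite_finite_induct) (simp_all add: selfadjoint_def)

text \<open>The product rule: taking the adjoint conjugates \<open>- \<i>\<close> and moves the
  self-adjoint \<open>H\<close> to the right, producing the commutator.\<close>

lemma has_vector_derivative_conjugation:
  fixes V :: "real \<Rightarrow> complex ^ 'a::finite ^ 'a"
  assumes V: "(V has_vector_derivative (- \<i>) *\<^sub>c (H ** V s)) (at s within S)" and H: "adj H = H"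
  shows "((\<lambda>s. V s ** A ** adj (V s)) has_vector_derivative
    (- \<i>) *\<^sub>c (H ** (V s ** A ** adj (V s)) - (V s ** A ** adj (V s)) ** H)) (at s within S)"
proof -
  have adjV: "((\<lambda>s. adj (V s)) has_vector_derivative adj ((- \<i>) *\<^sub>c (H ** V s))) (at s within S)"
    by (rule bounded_linear.has_vector_derivative[OF bounded_linear_adj V])
  have "((\<lambda>s. V s ** A) has_vector_derivative ((- \<i>) *\<^sub>c (H ** V s)) ** A) (at s within S)"
    by (rule bounded_linear.has_vector_derivative[OF bounded_bilinear.bounded_linear_left[OF bounded_bilinear_matrix_mult] V])
  from bounded_bilinear.has_vector_derivative[OF bounded_bilinear_matrix_mult this adjV]
  show ?thesis
    by (rule back_subst[where P = "\<lambda>D. (_ has_vector_derivative D) _"])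
      (simp add: cscale_mult cscale_simps matrix_mul_assoc matrix_minus_mult H)
qed

text \<open>The variation bound with \<open>R = 0\<close>, integrated; conservation thus follows
  from the flow equation itself.\<close>

lemma trace_norm_commutator_flow_const:
  fixes X :: "real \<Rightarrow> complex ^ 'a::finite ^ 'a"
  assumes "\<And>s. s \<in> {a..b} \<Longrightarrow>
      (X has_vector_derivative (- \<i>) *\<^sub>c (K s ** X s - X s ** K s)) (at s within {a..b})"
    and K: "\<And>s. adj (K s) = K s" and ab: "a \<le> b"
  shows "trace_norm (X b) = trace_norm (X a)"
proof -
  have "\<bar>trace_norm (X b) - trace_norm (X a)\<bar> \<le> integral {a..b} (\<lambda>s. 0)"
  proof (rule abs_increment_le_integral[OF ab])
    fix s e :: real assume "s \<in> {a..b}" "e > 0"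
    then show "\<exists>d>0. \<forall>t\<in>{a..b}. \<bar>t - s\<bar> < d \<longrightarrow>
        \<bar>trace_norm (X t) - trace_norm (X s)\<bar> \<le> (0 + e) * \<bar>t - s\<bar>"
      using trace_norm_variation[of X "K s" s 0 "{a..b}" e] assms(1) K by (simp add: trace_norm_zero)
  qed simp
  then show ?thesis by simp
qed

lemma d_op_flow_variation:
  fixes h :: "nat \<Rightarrow> ('n::finite) op" and X :: "real \<Rightarrow> 'n op"
  assumes sa: "\<And>k. k \<in> {1..m} \<Longrightarrow> selfadjoint (h k)"
    and supp: "\<And>k. k \<in> {1..m} \<Longrightarrow> supported_on (T k) (h k)"
    and one: "\<And>k. k \<in> {1..m} \<Longrightarrow> op_norm (h k) = 1"
    and H: "H = (\<Sum>k=1..m. r k *\<^sub>R h k)"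
    and X: "(X has_vector_derivative (- \<i>) *\<^sub>c (H ** X s - X s ** H)) (at s within S)"
    and e: "e > 0"
  shows "\<exists>d>0. \<forall>t\<in>S. \<bar>t - s\<bar> < d \<longrightarrow>
    \<bar>trace_norm (d_op j (X t)) - trace_norm (d_op j (X s))\<bar>
      \<le> ((\<Sum>k=1..m. if j \<in> T k then 4 * \<bar>r k\<bar> * trace_norm (X s) else 0) + e) * \<bar>t - s\<bar>"
proof -
  define C where "C k = h k ** X s - X s ** h k" for k
  define N where "N = {k \<in> {1..m}. j \<notin> T k}"
  define M where "M = {k \<in> {1..m}. j \<in> T k}"
  define K where "K = (\<Sum>k\<in>N. r k *\<^sub>R h k)"
  define R where "R = d_op j ((- \<i>) *\<^sub>c (\<Sum>k\<in>M. r k *\<^sub>R C k))"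
  have NM: "{1..m} = N \<union> M" "N \<inter> M = {}" "finite N" "finite M" by (auto simp: N_def M_def)
  have comm: "h k ** pauli_Z j = pauli_Z j ** h k" "h k ** pauli_X j = pauli_X j ** h k" if "k \<in> N" for k
    using supported_on_commute_pauli[of "T k" "h k" j] supp that by (auto simp: N_def)
  have K_comm: "K ** pauli_Z j = pauli_Z j ** K" "K ** pauli_X j = pauli_X j ** K"
    unfolding K_def matrix_sum_mult by (auto intro!: sum.cong simp: matrix_scaleR_mult comm)
  have "H ** X s - X s ** H = (K ** X s - X s ** K) + (\<Sum>k\<in>M. r k *\<^sub>R C k)"
    unfolding H K_def NM(1) sum.union_disjoint[OF NM(3,4,2)]
    by (simp add: matrix_add_distrib matrix_sum_mult C_def scaleR_diff_right sum_subtractf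
        matrix_scaleR_mult)
  \<comment> \<open>\<open>K\<close> collects the terms acting off qubit \<open>j\<close> and passes
    through \<open>d_op j\<close>, leaving a commutator with \<open>d_op j (X s)\<close>.\<close>
  then have deriv: "d_op j ((- \<i>) *\<^sub>c (H ** X s - X s ** H))
      = (- \<i>) *\<^sub>c (K ** d_op j (X s) - d_op j (X s) ** K) + R"
    by (simp only: R_def cscale_simps(1) d_op_linear d_op_simps d_op_mult_commuting[OF K_comm])
  have R: "trace_norm R \<le> (\<Sum>k=1..m. if j \<in> T k then 4 * \<bar>r k\<bar> * trace_norm (X s) else 0)"
  proof -
    have "trace_norm R \<le> 2 * trace_norm ((- \<i>) *\<^sub>c (\<Sum>k\<in>M. r k *\<^sub>R C k))"
      unfolding R_def by (rule trace_norm_d_op)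
    also have "\<dots> \<le> 2 * trace_norm (\<Sum>k\<in>M. r k *\<^sub>R C k)"
      using trace_norm_cscale[of "- \<i>" "\<Sum>k\<in>M. r k *\<^sub>R C k"] by simp
    \<comment> \<open>The outer 2 comes from \<open>d_op j\<close>, the inner 2 from the commutator
      with \<open>op_norm (h k) = 1\<close>.\<close>
    also have "\<dots> \<le> 2 * (\<Sum>k\<in>M. \<bar>r k\<bar> * (2 * trace_norm (X s)))"
    proof (intro mult_left_mono order_trans[OF trace_norm_sum] sum_mono)
      fix k assume "k \<in> M"
      then have "trace_norm (C k) \<le> 2 * trace_norm (X s)"
        using trace_norm_commutator[of "h k" "X s"] one[of k] by (simp add: C_def M_def)
      then show "trace_norm (r k *\<^sub>R C k) \<le> \<bar>r k\<bar> * (2 * trace_norm (X s))"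
        by (intro order_trans[OF trace_norm_scaleR] mult_left_mono) auto
    qed simp
    also have "\<dots> = (\<Sum>k\<in>M. 4 * \<bar>r k\<bar> * trace_norm (X s))"
      by (simp add: sum_distrib_left mult_ac)
    also have "\<dots> = (\<Sum>k=1..m. if j \<in> T k then 4 * \<bar>r k\<bar> * trace_norm (X s) else 0)"
      unfolding M_def by (rule sum.inter_filter) simp
    finally show ?thesis .
  qed
  have "((\<lambda>t. d_op j (X t)) has_vector_derivative
      (- \<i>) *\<^sub>c (K ** d_op j (X s) - d_op j (X s) ** K) + R) (at s within S)"
    unfolding deriv[symmetric] by (rule bounded_linear.has_vector_derivative[OF bounded_linear_d_op X])
  moreover have "adj K = K"
    unfolding K_def using sa by (intro selfadjoint_sum_scaleR) (auto simp: N_def)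
  ultimately obtain d where "d > 0" and d: "\<And>t. t \<in> S \<Longrightarrow> \<bar>t - s\<bar> < d \<Longrightarrow>
      \<bar>trace_norm (d_op j (X t)) - trace_norm (d_op j (X s))\<bar> \<le> (trace_norm R + e) * \<bar>t - s\<bar>"
    using trace_norm_variation[where X = "\<lambda>t. d_op j (X t)" and K = K] e by blast
  then show ?thesis
    using R by (intro exI[of _ d]) (auto intro!: order_trans[OF d] mult_right_mono)
qed

lemma Inf1_increment_le:
  fixes h :: "nat \<Rightarrow> ('n::finite) op" and A U :: "'n op" and r :: "nat \<Rightarrow> real \<Rightarrow> real"
  assumes sa: "\<And>k. k \<in> {1..m} \<Longrightarrow> selfadjoint (h k)"
    and supp: "\<And>k. k \<in> {1..m} \<Longrightarrow> card (T k) \<le> 2 \<and> supported_on (T k) (h k)"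
    and one: "\<And>k. k \<in> {1..m} \<Longrightarrow> op_norm (h k) = 1"
    and r: "\<And>k. k \<in> {1..m} \<Longrightarrow> continuous_on {0..1} (r k)"
    and U: "path_ordered_exp (\<lambda>s. \<Sum>k=1..m. r k s *\<^sub>R h k) U"
  shows "\<bar>Inf1 (U ** A ** adj U) - Inf1 A\<bar> \<le> 8 * integral {0..1} (\<lambda>s. \<Sum>k=1..m. \<bar>r k s\<bar>) * norm1 A"
proof -
  define H where "H s = (\<Sum>k=1..m. r k s *\<^sub>R h k)" for s
  define a where "a = trace_norm A"
  obtain V where V0: "V 0 = mat 1" and V1: "U = V 1"
    and V: "\<And>s. s \<in> {0..1} \<Longrightarrow> (V has_vector_derivative (- \<i>) *\<^sub>c (H s ** V s)) (at s within {0..1})"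
    using U unfolding path_ordered_exp_def H_def by blast
  define X where "X s = V s ** A ** adj (V s)" for s
  have H: "adj (H s) = H s" for s unfolding H_def using sa by (intro selfadjoint_sum_scaleR) auto
  have X: "(X has_vector_derivative (- \<i>) *\<^sub>c (H s ** X s - X s ** H s)) (at s within {0..1})"
    if "s \<in> {0..1}" for s
    unfolding X_def by (rule has_vector_derivative_conjugation[OF V[OF that] H])
  have X0: "X 0 = A" by (simp add: X_def V0)
  have X1: "X 1 = U ** A ** adj U" by (simp add: X_def V1)
  \<comment> \<open>Conservation of the trace norm makes the rate bound depend on \<open>s\<close>
    only through the coefficients \<open>r k s\<close>.\<close>
  have norm_X: "trace_norm (X s) = a" if "s \<in> {0..1}" for s
  proof -
    have "trace_norm (X s) = trace_norm (X 0)"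
    proof (rule trace_norm_commutator_flow_const[where K = H])
      fix t assume "t \<in> {0..s}"
      then show "(X has_vector_derivative (- \<i>) *\<^sub>c (H t ** X t - X t ** H t)) (at t within {0..s})"
        using that by (intro has_vector_derivative_within_subset[OF X]) auto
    qed (use H that in auto)
    then show ?thesis by (simp add: X0 a_def)
  qed
  define g where "g j s = (\<Sum>k=1..m. if j \<in> T k then 4 * \<bar>r k s\<bar> * a else 0)" for j s
  have g: "continuous_on {0..1} (g j)" for j
    unfolding g_def
  proof (intro continuous_on_sum)
    show "continuous_on {0..1} (\<lambda>s. if j \<in> T k then 4 * \<bar>r k s\<bar> * a else 0)" if "k \<in> {1..m}" for k
      using r[OF that] by (cases "j \<in> T k") (auto intro!: continuous_intros)
  qed
  have step: "\<bar>trace_norm (d_op j (X 1)) - trace_norm (d_op j (X 0))\<bar> \<le> integral {0..1} (g j)" for j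
  proof (rule abs_increment_le_integral[OF _ g])
    fix s e :: real assume s: "s \<in> {0..1}" and e: "e > 0"
    show "\<exists>d>0. \<forall>t\<in>{0..1}. \<bar>t - s\<bar> < d \<longrightarrow>
        \<bar>trace_norm (d_op j (X t)) - trace_norm (d_op j (X s))\<bar> \<le> (g j s + e) * \<bar>t - s\<bar>"
      unfolding g_def norm_X[OF s, symmetric]
      by (rule d_op_flow_variation[where h = h and H = "H s"])
        (use sa supp one X[OF s] e in \<open>auto simp: H_def\<close>)
  qed simp
  have cont_r: "continuous_on {0..1} (\<lambda>s. \<Sum>k=1..m. \<bar>r k s\<bar>)"
    using r by (auto intro!: continuous_intros)
  have "\<bar>\<Sum>j\<in>UNIV. trace_norm (d_op j (X 1)) - trace_norm (d_op j (X 0))\<bar>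
      \<le> (\<Sum>j\<in>UNIV. integral {0..1} (g j))"
    by (intro order_trans[OF sum_abs] sum_mono step)
  also have "\<dots> = integral {0..1} (\<lambda>s. \<Sum>j\<in>UNIV. g j s)"
    by (rule integral_sum[symmetric]) (auto intro!: integrable_continuous_real g)
  also have "\<dots> \<le> integral {0..1} (\<lambda>s. (8 * a) * (\<Sum>k=1..m. \<bar>r k s\<bar>))"
  proof (intro integral_le integrable_continuous_real continuous_intros g cont_r)
    fix s :: real
    \<comment> \<open>Exchanging the sums counts term \<open>k\<close> once for each qubit in
      \<open>T k\<close>, at most twice, so 8 is 2 times 4.\<close>
    have "(\<Sum>j\<in>UNIV. g j s) = (\<Sum>k=1..m. \<Sum>j\<in>UNIV. if j \<in> T k then 4 * \<bar>r k s\<bar> * a else 0)"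
      unfolding g_def by (rule sum.swap)
    also have "\<dots> = (\<Sum>k=1..m. real (card (T k)) * (4 * \<bar>r k s\<bar> * a))"
      by (simp add: sum.If_cases)
    also have "\<dots> \<le> (\<Sum>k=1..m. 2 * (4 * \<bar>r k s\<bar> * a))"
      using supp by (intro sum_mono mult_right_mono) (auto simp: a_def trace_norm_nonneg)
    finally show "(\<Sum>j\<in>UNIV. g j s) \<le> (8 * a) * (\<Sum>k=1..m. \<bar>r k s\<bar>)"
      by (simp add: sum_distrib_left mult_ac)
  qed (use r in blast)
  also have "\<dots> = (8 * a) * integral {0..1} (\<lambda>s. \<Sum>k=1..m. \<bar>r k s\<bar>)" by simp
  finally have "\<bar>(\<Sum>j\<in>UNIV. trace_norm (d_op j (X 1))) - (\<Sum>j\<in>UNIV. trace_norm (d_op j A))\<bar>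
      \<le> (8 * a) * integral {0..1} (\<lambda>s. \<Sum>k=1..m. \<bar>r k s\<bar>)"
    by (simp add: X0 sum_subtractf)
  then show ?thesis
    unfolding Inf1_def norm1_eq X1[symmetric] a_def[symmetric] sum_divide_distrib[symmetric]
      diff_divide_distrib[symmetric] by (simp add: divide_right_mono mult_ac)
qed

section \<open>From a single path to the infimum over all paths\<close>

theorem theorem6p4:
  fixes h :: "nat \<Rightarrow> ('n::finite) op" and m :: nat and U :: "'n op"
  assumes "\<And>i. i \<in> {1..m} \<Longrightarrow> trace (h i) = 0"
    and "\<And>i. i \<in> {1..m} \<Longrightarrow> selfadjoint (h i)"
    and "\<And>i. i \<in> {1..m} \<Longrightarrow> \<exists>S. card S \<le> 2 \<and> supported_on S (h i)"
    and "\<And>i. i \<in> {1..m} \<Longrightarrow> op_norm (h i) = 1"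
    and "unitary U"
  shows "CiS1 U \<le> 8 * Cost m h U"
proof -
  define T where "T i = (SOME S. card S \<le> 2 \<and> supported_on S (h i))" for i
  have T: "card (T i) \<le> 2 \<and> supported_on (T i) (h i)" if "i \<in> {1..m}" for i
    unfolding T_def using assms(3)[OF that] by (rule someI_ex)
  \<comment> \<open>In this form the claim says that the left side is a lower bound of the set of
    path costs, which also covers the empty set, where the cost is infinite.\<close>
  have "CiS1 U / 8 \<le> Cost m h U"
    unfolding Cost_def
  proof (rule Inf_greatest)
    fix c assume "c \<in> {ereal (integral {0..1} (\<lambda>s. \<Sum>j=1..m. \<bar>r j s\<bar>)) | r :: nat \<Rightarrow> real \<Rightarrow> real.
      (\<forall>j\<in>{1..m}. continuous_on {0..1} (r j)) \<and>
      path_ordered_exp (\<lambda>s. \<Sum>j=1..m. r j s *\<^sub>R h j) U}"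
    then obtain r :: "nat \<Rightarrow> real \<Rightarrow> real"
      where c: "c = ereal (integral {0..1} (\<lambda>s. \<Sum>j=1..m. \<bar>r j s\<bar>))"
        and r: "\<forall>j\<in>{1..m}. continuous_on {0..1} (r j)"
        and U: "path_ordered_exp (\<lambda>s. \<Sum>j=1..m. r j s *\<^sub>R h j) U"
      unfolding mem_Collect_eq by (elim exE conjE)
    have "CiS1 U \<le> ereal (8 * integral {0..1} (\<lambda>s. \<Sum>j=1..m. \<bar>r j s\<bar>))"
      unfolding CiS1_def
    proof (rule SUP_least)
      fix A :: "'n op" assume "A \<in> {A. norm1 A = 1}"
      then have "norm1 A = 1" by (rule CollectD)
      moreover have "\<bar>Inf1 (U ** A ** adj U) - Inf1 A\<bar>
          \<le> 8 * integral {0..1} (\<lambda>s. \<Sum>j=1..m. \<bar>r j s\<bar>) * norm1 A"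
        by (rule Inf1_increment_le[where T = T, OF assms(2) T assms(4) bspec[OF r] U])
      ultimately show "ereal \<bar>Inf1 (U ** A ** adj U) - Inf1 A\<bar>
          \<le> ereal (8 * integral {0..1} (\<lambda>s. \<Sum>j=1..m. \<bar>r j s\<bar>))"
        by (simp only: mult_1_right ereal_less_eq(3))
    qed
    then show "CiS1 U / 8 \<le> c"
      by (simp add: c ereal_divide_le_pos)
  qed
  then show ?thesis by (simp add: ereal_divide_le_pos)
qed

end
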